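(* Let $K$ be an imaginary quadratic field with discriminant $\Delta<0$, ring of integers $\mathcal{O}_K$ and norm $N(x)=x\overline{x}$. Let $C$ be an oriented $K$-Bianchi circle of reduced curvature $b$, and suppose $C=M(\widehat{\mathbb{R}})$ for $M=\begin{pmatrix}\alpha&\gamma\\ \beta&\delta\end{pmatrix}\in\mathrm{PGL}_2(\mathcal{O}_K)$. Let $\Lambda=\beta\mathbb{Z}+\delta\mathbb{Z}\subset\mathcal{O}_K$. Then the set of reduced curvatures of the oriented $K$-Bianchi circles immediately tangent to $C$ is exactly the set of values $N(x)-b$ as $x$ ranges over the primitive elements of $\Lambda$ (elements $x\in\Lambda\setminus\{0\}$ not of the form $my$ with $y\in\Lambda$ and $m\ge 2$ an integer).
   Context: Matrices $\begin{pmatrix}\alpha&\gamma\\ \beta&\delta\end{pmatrix}$ act on $\widehat{\mathbb{C}}=\mathbb{C}\cup\{\infty\}$ by $z\mapsto(\alpha z+\gamma)/(\beta z+\delta)$; $\mathrm{PGL}_2(\mathcal{O}_K)$ is $\mathrm{GL}_2(\mathcal{O}_K)$ modulo unit scalars. Circles include lines (circles through $\infty$). An oriented circle is a circle with a direction of travel; its interior is the region to the left of the direction of travel. Positive orientation means counterclockwise for circles not through $\infty$; for lines other than $\widehat{\mathbb{R}}$ it means travel in the direction of increasing imaginary part; for $\widehat{\mathbb{R}}$ it means travel to the right. $\widehat{\mathbb{R}}$ as an oriented circle denotes the positively oriented real line (interior the upper half plane), and Möbius transformations act on oriented circles taking interiors to interiors, so $M(\widehat{\mathbb{R}})$ is an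 oriented circle. A $K$-Bianchi circle is an image of $\widehat{\mathbb{R}}$ under $\mathrm{PSL}_2(\mathcal{O}_K)$; an oriented $K$-Bianchi circle is an oriented circle whose underlying circle is a $K$-Bianchi circle; $\mathcal{S}_K$ denotes the set of $K$-Bianchi circles. The (signed) curvature of an oriented circle not through $\infty$ of radius $r$ is $1/r$ if positively oriented and $-1/r$ if negatively oriented, and is $0$ for lines; the curvature of an oriented $K$-Bianchi circle is an integer multiple of $\sqrt{-\Delta}$, and that integer is its reduced curvature. A collection $\mathcal{P}$ of circles straddles a circle $C$ if $\mathcal{P}$ contains a circle $C'\neq C$ disjoint from the interior of $C$ and a circle $C''\neq C$ disjoint from the exterior of $C$. Two oriented $K$-Bianchi circles are immediately tangent if they are externally tangent and the pair straddles no circle of $\mathcal{S}_K$.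
   Formalization: For b = 0 (Λ of rank 1) the claim is false as stated (C = real line, Λ = Z: curvature 0 occurs but N(x) = 1), so the literal claim is proved for b ≠ 0; for every b the same equality is proved with x = mβ + nδ, gcd(m,n) = 1, in place of primitive elements. *)

theory Defs
  imports "HOL-Analysis.Analysis"
begin

section \<open>Imaginary quadratic fields\<close>

text \<open>
  An imaginary quadratic field is taken together with its embedding in the complex numbers: a
  subfield of \<open>\<complex>\<close> of degree 2 over \<open>\<rat>\<close> that is not contained in \<open>\<real>\<close>.
\<close>

definition complex_subfield :: "complex set \<Rightarrow> bool" where
  "complex_subfield K \<longleftrightarrow>
     1 \<in> K \<and> (\<forall>x\<in>K. \<forall>y\<in>K. x - y \<in> K \<and> x * y \<in> K) \<and> (\<forall>x\<in>K. inverse x \<in> K)"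

definition imaginary_quadratic_field :: "complex set \<Rightarrow> bool" where
  "imaginary_quadratic_field K \<longleftrightarrow>
     complex_subfield K \<and>
     vector_space.dim (\<lambda>(q::rat) (z::complex). of_rat q * z) K = 2 \<and>
     \<not> K \<subseteq> \<real>"

definition ring_of_integers :: "complex set \<Rightarrow> complex set" where
  "ring_of_integers K = {x \<in> K. algebraic_int x}"

text \<open>The additive subgroup \<open>\<int>v + \<int>w\<close>; it has rank 1 if \<open>v\<close> and \<open>w\<close> are \<open>\<rat>\<close>-proportional.\<close>

definition int_span2 :: "complex \<Rightarrow> complex \<Rightarrow> complex set" where
  "int_span2 v w = {of_int m * v + of_int n * w | m n. True}"

text \<open>
  The discriminant is the square of the determinant of the matrix of the two embeddings (the
  identity and complex conjugation) evaluated on an integral basis. Two elements that generate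
  the ring of integers additively are automatically a basis, as its rank is 2.
\<close>

definition field_discriminant :: "complex set \<Rightarrow> int" where
  "field_discriminant K =
     (THE D. \<exists>v w. ring_of_integers K = int_span2 v w \<and>
                   of_int D = (v * cnj w - w * cnj v)\<^sup>2)"


section \<open>Moebius transformations and oriented circles\<close>

text \<open>
  The Riemann sphere is \<^typ>\<open>complex option\<close> with \<^const>\<open>None\<close> as the point at infinity, as for
  \<^const>\<open>Alexandroff_compactification\<close>.
\<close>

definition moebius :: "complex^2^2 \<Rightarrow> complex option \<Rightarrow> complex option" where
  "moebius M p =
     (case p of
        None \<Rightarrow> if M$2$1 = 0 then None else Some (M$1$1 / M$2$1)
      | Some z \<Rightarrow> if M$2$1 * z + M$2$2 = 0 then None
                  else Some ((M$1$1 * z + M$1$2) / (M$2$1 * z + M$2$2)))"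

text \<open>
  A direction of travel along a circle is recorded by the region to its left: an oriented
  circle is the pair of its underlying circle and its interior.
\<close>

datatype ocircle = OCircle (underlying: "complex option set") (ointerior: "complex option set")

definition ccw_circle :: "complex \<Rightarrow> real \<Rightarrow> ocircle" where
  "ccw_circle c r = OCircle (Some ` sphere c r) (Some ` ball c r)"

definition cw_circle :: "complex \<Rightarrow> real \<Rightarrow> ocircle" where
  "cw_circle c r = OCircle (Some ` sphere c r) (- (Some ` cball c r))"

text \<open>The line through \<open>p\<close>, travelled in the direction \<open>u\<close>.\<close>

definition directed_line :: "complex \<Rightarrow> complex \<Rightarrow> ocircle" where
  "directed_line p u =
     OCircle (insert None (Some ` {p + of_real t * u | t. True}))
             (Some ` {z. Im ((z - p) / u) > 0})"

definition oriented_circle :: "ocircle \<Rightarrow> bool" where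
  "oriented_circle C \<longleftrightarrow>
     (\<exists>c r. r > 0 \<and> (C = ccw_circle c r \<or> C = cw_circle c r)) \<or>
     (\<exists>p u. u \<noteq> 0 \<and> C = directed_line p u)"

definition oexterior :: "ocircle \<Rightarrow> complex option set" where
  "oexterior C = - (underlying C \<union> ointerior C)"

definition real_circle :: ocircle where
  "real_circle = directed_line 0 1"

definition moebius_ocircle :: "complex^2^2 \<Rightarrow> ocircle \<Rightarrow> ocircle" where
  "moebius_ocircle M C = OCircle (moebius M ` underlying C) (moebius M ` ointerior C)"

definition curvature :: "ocircle \<Rightarrow> real" where
  "curvature C =
     (if None \<in> underlying C then 0
      else THE k. \<exists>c r. r > 0 \<and> (C = ccw_circle c r \<and> k = 1 / r \<or>
                                 C = cw_circle c r \<and> k = - (1 / r)))"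

definition externally_tangent :: "ocircle \<Rightarrow> ocircle \<Rightarrow> bool" where
  "externally_tangent C C' \<longleftrightarrow>
     (\<exists>z. underlying C \<inter> underlying C' = {z}) \<and> ointerior C \<inter> ointerior C' = {}"

text \<open>
  The collection consists of unoriented circles. Reversing the orientation of \<open>C\<close> exchanges its
  interior and exterior and leaves this notion unchanged.
\<close>

definition straddles :: "complex option set set \<Rightarrow> ocircle \<Rightarrow> bool" where
  "straddles P C \<longleftrightarrow>
     (\<exists>C'\<in>P. C' \<noteq> underlying C \<and> C' \<inter> ointerior C = {}) \<and>
     (\<exists>C''\<in>P. C'' \<noteq> underlying C \<and> C'' \<inter> oexterior C = {})"


section \<open>Bianchi circles\<close>

text \<open>
  Elements of the projective groups are given by representing matrices; scalars act trivially
  on the Riemann sphere.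
\<close>

definition GL2 :: "complex set \<Rightarrow> (complex^2^2) set" where
  "GL2 R = {M. (\<forall>i j. M$i$j \<in> R) \<and> (\<exists>u\<in>R. det M * u = 1)}"

definition SL2 :: "complex set \<Rightarrow> (complex^2^2) set" where
  "SL2 R = {M. (\<forall>i j. M$i$j \<in> R) \<and> det M = 1}"

definition bianchi_circles :: "complex set \<Rightarrow> complex option set set" where
  "bianchi_circles K = {moebius M ` underlying real_circle | M. M \<in> SL2 (ring_of_integers K)}"

definition oriented_bianchi_circle :: "complex set \<Rightarrow> ocircle \<Rightarrow> bool" where
  "oriented_bianchi_circle K C \<longleftrightarrow> oriented_circle C \<and> underlying C \<in> bianchi_circles K"

definition reduced_curvature :: "complex set \<Rightarrow> ocircle \<Rightarrow> int" where
  "reduced_curvature K C =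
     (THE b. curvature C = of_int b * sqrt (- of_int (field_discriminant K)))"

definition immediately_tangent :: "complex set \<Rightarrow> ocircle \<Rightarrow> ocircle \<Rightarrow> bool" where
  "immediately_tangent K C C' \<longleftrightarrow>
     oriented_bianchi_circle K C \<and> oriented_bianchi_circle K C' \<and>
     externally_tangent C C' \<and>
     \<not> (\<exists>D. oriented_circle D \<and> underlying D \<in> bianchi_circles K \<and>
            straddles {underlying C, underlying C'} D)"

definition primitive_in :: "complex set \<Rightarrow> complex \<Rightarrow> bool" where
  "primitive_in L x \<longleftrightarrow> x \<in> L \<and> x \<noteq> 0 \<and> \<not> (\<exists>(m::int) y. m \<ge> 2 \<and> y \<in> L \<and> x = of_int m * y)"

text \<open>
  The points \<open>m v + n w\<close> with \<open>(m, n)\<close> a primitive vector of \<open>\<int>\<^sup>2\<close>. If \<open>v\<close> and \<open>w\<close> are linearly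
  independent over \<open>\<rat>\<close>, these are exactly the elements \<open>x\<close> with
  \<^term>\<open>primitive_in (int_span2 v w) x\<close>. If the span has rank 1 the two notions differ: for
  \<open>v = 0\<close> and \<open>w = 1\<close> the only primitive elements of the span are \<open>1\<close> and \<open>-1\<close>, while every
  integer occurs as a primitive combination.
\<close>

definition primitive_combinations :: "complex \<Rightarrow> complex \<Rightarrow> complex set" where
  "primitive_combinations v w = {of_int m * v + of_int n * w | m n. coprime (m::int) n}"

end

theory Submission
  imports Defs
begin

text \<open>
  Moebius invariance reduces the problem to circles tangent to the real line. The tangency point,
  being a double root of an integral quadratic, is a cusp that \<open>SL\<^sub>2(\<int>)\<close> moves to infinity.
  There the Bianchi circles are the horizontal lines \<open>Im z = k Im w\<close> with \<open>k\<close> an integer, where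
  \<open>\<O>\<^sub>K = \<int> + \<int>w\<close>; the immediately tangent one is the neighbour \<open>k = -1\<close>. If the tangency
  point is \<open>M(m/n)\<close> and \<open>x = m \<beta> + n \<delta>\<close>, a matrix for \<open>C\<close> has bottom row \<open>(x, y)\<close>, one for the
  neighbour has bottom row \<open>(-x, y - w x)\<close>, and the curvature \<open>2 Im (cnj (-x) (y - w x))\<close> of the
  latter equals \<open>2 Im w (N(x) - b)\<close>.
\<close>


text \<open>Straddling quantifies over every Bianchi circle, but once the point of tangency is at
  infinity both circles pass through infinity, and so must any circle that straddles them: infinity
  may lie neither in its interior nor in its exterior. It is then a line, parallel to the two since
  it cannot cross them, and such lines have heights in \<open>\<int> Im w\<close>. Straddling thus
  asks for an integer strictly between two others. The obstacle is that \<open>M\<close> has only a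
  unit determinant, whereas \<open>bianchi_circles\<close> uses determinant 1. That \<open>C\<close>
  itself is a Bianchi circle forces \<open>det M\<close> to be \<plusminus> the square of a unit.
  This makes the neighbours of \<open>C\<close> Bianchi circles, and these are also the circles that
  straddle \<open>C\<close> and any more distant tangent circle. In units of \<open>Im w\<close>,
  \<open>b\<close> is the value of the alternating form \<open>Im (cnj \<beta> * \<delta>)\<close>.
  It does not change under \<open>SL\<^sub>2(\<int>)\<close>, so the same \<open>b\<close> appears
  at every cusp and only \<open>N(x)\<close> varies.\<close>

section \<open>Integers of imaginary quadratic fields\<close>

text \<open>Gauss's lemma: the primitive part \<open>g\<close> of the quadratic divides every
  integer polynomial that vanishes at \<open>z\<close>, in particular a monic one. So its leading
  coefficient is a unit, and \<open>a\<close> divides the content.\<close>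

lemma algebraic_int_quadratic_dvd:
  fixes z :: complex and a b c :: int
  assumes "algebraic_int z" and "z \<notin> \<real>" and "a \<noteq> 0"
    and root: "of_int a * z\<^sup>2 + of_int b * z + of_int c = 0"
  shows "a dvd b \<and> a dvd c"
proof -
  define ev where "ev p = poly (map_poly of_int p) z" for p :: "int poly"
  have ev_pCons [simp]: "ev (pCons k p) = of_int k + z * ev p" and [simp]: "ev 0 = 0" for k p
    by (simp_all add: ev_def map_poly_pCons)
  have ev_add: "ev (p + q) = ev p + ev q" for p q
    by (induction p q rule: poly_induct2) (simp_all add: algebra_simps)
  have ev_smult: "ev (smult k p) = of_int k * ev p" for p k
    by (induction p) (simp_all add: algebra_simps)
  have ev_mult: "ev (p * q) = ev p * ev q" for p q
    by (induction p) (simp_all add: ev_add ev_smult algebra_simps)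
  obtain p where p: "ev p = 0" "lead_coeff p = 1"
    using assms(1) unfolding algebraic_int_altdef_ipoly ev_def by blast
  define f where "f = [:c, b, a:]"
  define g where "g = primitive_part f"
  have "f \<noteq> 0" and "degree f = 2" using \<open>a \<noteq> 0\<close> by (auto simp: f_def)
  have fg: "f = smult (content f) g" by (simp add: g_def)
  have "ev f = 0" using root by (simp add: f_def algebra_simps power2_eq_square)
  have cont: "content g = 1" using \<open>f \<noteq> 0\<close> by (simp add: g_def)
  have "content f \<noteq> 0" using \<open>f \<noteq> 0\<close> by simp
  have "ev g = 0"
    using \<open>ev f = 0\<close> \<open>content f \<noteq> 0\<close> by (subst (asm) fg) (simp add: ev_smult)
  have "g \<noteq> 0" "degree g = 2" using \<open>degree f = 2\<close> \<open>f \<noteq> 0\<close> by (auto simp: g_def)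
  \<comment> \<open>Pseudo-division stays over the integers at the price of the factor
    \<open>k\<close>.\<close>
  obtain k h where k: "k \<noteq> 0" and div: "smult k p = g * h + pseudo_mod p g"
    and deg: "pseudo_mod p g = 0 \<or> degree (pseudo_mod p g) < degree g"
    using pseudo_mod[OF \<open>g \<noteq> 0\<close>, of p] by blast
  have "ev (pseudo_mod p g) = 0"
    using arg_cong[OF div, of ev] p(1) \<open>ev g = 0\<close> by (simp add: ev_add ev_mult ev_smult)
  have "degree (pseudo_mod p g) \<le> 1" using deg \<open>degree g = 2\<close> by auto
  then have "pseudo_mod p g = [:coeff (pseudo_mod p g) 0, coeff (pseudo_mod p g) 1:]"
    by (intro poly_eqI) (auto simp: coeff_pCons coeff_eq_0 split: nat.split)
  then obtain r0 r1 where r: "pseudo_mod p g = [:r0, r1:]" by blast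
  \<comment> \<open>A linear integer polynomial with a non-real root is zero.\<close>
  have "of_int r0 + z * of_int r1 = 0"
    using \<open>ev (pseudo_mod p g) = 0\<close> by (simp add: r)
  then have "r1 = 0" "r0 = 0"
    using \<open>z \<notin> \<real>\<close> by (auto simp: complex_eq_iff complex_is_Real_iff)
  then have eq: "smult k p = g * h" using div r by simp
  \<comment> \<open>Contents are multiplicative and \<open>g\<close> is primitive, so
    \<open>k\<close> divides \<open>h\<close> and cancels.\<close>
  have "normalize k * Polynomial.content p = Polynomial.content (smult k p)" by simp
  also have "\<dots> = Polynomial.content g * Polynomial.content h" unfolding eq by (rule content_mult)
  finally have "normalize k * Polynomial.content p = Polynomial.content h" using cont by simp
  then have "[:k:] dvd h"
    by (metis const_poly_dvd_iff_dvd_content dvd_def normalize_dvd_iff)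
  then obtain h' where "h = smult k h'" by (auto elim: dvdE)
  then have "smult k p = smult k (g * h')" using eq by simp
  then have "p = g * h'" using k smult_cancel by blast
  then have "lead_coeff g * lead_coeff h' = 1" using p(2) by (simp add: lead_coeff_mult)
  then have "lead_coeff g dvd 1" by (metis dvd_triv_left)
  moreover have "a = content f * lead_coeff g"
    using arg_cong[OF fg, of "\<lambda>p. coeff p 2"] \<open>degree g = 2\<close> by (simp add: f_def numeral_2_eq_2)
  ultimately have "a dvd content f"
    by (metis dvd_refl mult.right_neutral mult_dvd_mono)
  moreover have "content f dvd coeff f 0" "content f dvd coeff f 1" by simp_all
  ultimately show ?thesis by (auto simp: f_def intro: dvd_trans)
qed

text \<open>Clearing denominators gives the leading coefficient \<open>b * e\<close>; that it
  divides the other two coefficients amounts to \<open>b dvd a\<close> and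
  \<open>e dvd c\<close>.\<close>

lemma algebraic_int_quadratic_Ints:
  fixes z t n :: complex
  assumes "algebraic_int z" and "z \<notin> \<real>" and "t \<in> \<rat>" and "n \<in> \<rat>"
    and root: "z\<^sup>2 - t * z + n = 0"
  shows "t \<in> \<int> \<and> n \<in> \<int>"
proof -
  obtain a b :: int where ab: "b > 0" "t = of_int a / of_int b"
    using \<open>t \<in> \<rat>\<close> by (elim Rats_cases') auto
  obtain c e :: int where ce: "e > 0" "n = of_int c / of_int e"
    using \<open>n \<in> \<rat>\<close> by (elim Rats_cases') auto
  have "of_int (b * e) * (z\<^sup>2 - t * z + n)
      = of_int (b * e) * z\<^sup>2 + of_int (- a * e) * z + of_int (c * b)"
    using ab ce by (simp add: field_simps)
  then have "of_int (b * e) * z\<^sup>2 + of_int (- a * e) * z + of_int (c * b) = 0"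
    using root by simp
  moreover have "b * e \<noteq> 0" using ab(1) ce(1) by simp
  ultimately have "b * e dvd - a * e \<and> b * e dvd c * b"
    using algebraic_int_quadratic_dvd[OF assms(1,2)] by blast
  then have "b dvd a" "e dvd c" using ab(1) ce(1) by (auto simp: mult.commute)
  then show ?thesis using ab ce by auto
qed

lemma algebraic_int_int_combination:
  fixes w :: complex and T N m n :: int
  assumes "w\<^sup>2 = of_int T * w - of_int N"
  shows "algebraic_int (of_int m + of_int n * w)"
  unfolding algebraic_int_altdef_ipoly
proof (intro exI conjI)
  \<comment> \<open>This is \<open>X^2 - trace * X + norm\<close> for the element
    \<open>m + n w\<close>, with \<open>T\<close> and \<open>N\<close> in the roles of trace and
    norm of \<open>w\<close>.\<close>
  let ?p = "[:m\<^sup>2 + m * n * T + n\<^sup>2 * N, - (2 * m + n * T), 1:] :: int poly"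
  show "lead_coeff ?p = 1" by simp
  have "poly (map_poly of_int ?p) (of_int m + of_int n * w) =
      (of_int n)\<^sup>2 * (w\<^sup>2 - of_int T * w + of_int N)"
    by (simp add: map_poly_pCons algebra_simps power2_eq_square)
  then show "poly (map_poly of_int ?p) (of_int m + of_int n * w) = 0" using assms by simp
qed

section \<open>Subfields of degree two over the rationals\<close>

lemma complex_of_rat_Reals: "complex_of_rat q \<in> \<real>"
  by (cases q) (simp add: of_rat_rat)

lemma complex_subfield_of_rat:
  assumes "complex_subfield K"
  shows "of_rat q \<in> K"
proof -
  have diff: "x - y \<in> K" if "x \<in> K" "y \<in> K" for x y
    using assms that by (simp add: complex_subfield_def)
  have "1 \<in> K" using assms by (simp add: complex_subfield_def)
  then have "0 \<in> K" using diff[of 1 1] by simp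
  have "of_nat n \<in> K" for n
  proof (induction n)
    case (Suc n)
    then show ?case using diff[OF \<open>1 \<in> K\<close> diff[OF \<open>0 \<in> K\<close> Suc]] by simp
  qed (use \<open>0 \<in> K\<close> in simp)
  then have ints: "of_int k \<in> K" for k
    by (cases k rule: int_cases2) (use diff[OF \<open>0 \<in> K\<close>] in auto)
  obtain a b where "q = Fract a b" "b > 0" by (cases q)
  then have "of_rat q = of_int a * inverse (of_int b :: complex)"
    by (simp add: of_rat_rat divide_inverse)
  then show ?thesis using assms ints by (simp add: complex_subfield_def)
qed

lemma complex_subfield_combination:
  assumes "complex_subfield K" and "x \<in> K"
  shows "of_rat p + of_rat q * x \<in> K"
proof -
  have "of_rat p - of_rat (- q) * x \<in> K"
    using assms complex_subfield_of_rat[OF assms(1)] unfolding complex_subfield_def by blast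
  then show ?thesis by (simp add: of_rat_minus)
qed

text \<open>Since \<theta> is not real, 1 and \<theta> are independent over the rationals; an
  \<open>x\<close> outside their span would give three independent vectors in the span of a basis
  with two elements.\<close>

lemma imaginary_quadratic_field_basis:
  assumes "imaginary_quadratic_field K" and "\<theta> \<in> K" and "\<theta> \<notin> \<real>" and "x \<in> K"
  shows "\<exists>p q. x = of_rat p + of_rat q * \<theta>"
proof -
  interpret V: vector_space "\<lambda>(q::rat) (z::complex). of_rat q * z"
    by unfold_locales (simp_all add: algebra_simps of_rat_add of_rat_mult)
  have sub: "complex_subfield K" and dim: "V.dim K = 2"
    using assms(1) by (auto simp: imaginary_quadratic_field_def)
  have span: "x \<in> V.span {\<theta>, 1} \<longleftrightarrow> (\<exists>p q. x = of_rat p + of_rat q * \<theta>)" for x :: complex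
  proof -
    have "x \<in> V.span {\<theta>, 1} \<longleftrightarrow> (\<exists>q p. x - of_rat q * \<theta> = of_rat p)"
      by (auto simp: V.span_breakdown_eq V.span_singleton)
    then show ?thesis by (auto simp: diff_eq_eq)
  qed
  then have "\<theta> \<notin> V.span {1}" using \<open>\<theta> \<notin> \<real>\<close> complex_of_rat_Reals by (auto simp: V.span_singleton)
  moreover have "\<theta> \<noteq> 1" using \<open>\<theta> \<notin> \<real>\<close> by auto
  ultimately have indep: "V.independent {\<theta>, 1}" and card: "card {\<theta>, 1} = 2"
    using \<open>\<theta> \<noteq> 1\<close> by (simp_all add: V.independent_insert)
  obtain B where B: "B \<subseteq> K" "V.independent B" "K \<subseteq> V.span B" "card B = 2"
    using V.basis_exists[of K] dim by metis
  show ?thesis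
  proof (rule ccontr)
    assume "\<not> ?thesis"
    then have x: "x \<notin> V.span {\<theta>, 1}" by (simp add: span)
    then have "V.independent {x, \<theta>, 1}" using indep by (simp add: V.independent_insert)
    moreover have "{x, \<theta>, 1} \<subseteq> V.span B"
      using assms B(3) sub by (auto simp: complex_subfield_def)
    \<comment> \<open>Infinite sets have cardinality 0, not 2.\<close>
    moreover have "finite B" using B(4) card.infinite by fastforce
    ultimately have "card {x, \<theta>, 1} \<le> 2" using V.independent_span_bound[of B] B(4) by simp
    moreover have "x \<notin> {\<theta>, 1}" using x V.span_base by blast
    ultimately show False using card by simp
  qed
qed

text \<open>Completing the square in a quadratic relation for a non-real \<open>t\<close> gives
  \<open>y\<close> with rational square \<open>a / b\<close>. It is negative because
  \<open>y\<close> is not real, and \<open>b * y\<close> has the integer square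
  \<open>a * b\<close>.\<close>

lemma imaginary_quadratic_field_sqrt:
  assumes K: "imaginary_quadratic_field K"
  shows "\<exists>d>0. \<exists>x\<in>K. x\<^sup>2 = - of_nat d"
proof -
  have sub: "complex_subfield K" using K by (simp add: imaginary_quadratic_field_def)
  obtain t where t: "t \<in> K" "t \<notin> \<real>" using K by (auto simp: imaginary_quadratic_field_def)
  have "t * t \<in> K" using sub t by (simp add: complex_subfield_def)
  then obtain p q where pq: "t * t = of_rat p + of_rat q * t"
    using imaginary_quadratic_field_basis[OF K t] by blast
  define y where "y = of_rat (- q / 2) + of_rat 1 * t"
  have yK: "y \<in> K" unfolding y_def by (rule complex_subfield_combination[OF sub t(1)])
  have "y \<notin> \<real>"
  proof
    assume "y \<in> \<real>"
    then have "y - of_rat (- q / 2) \<in> \<real>" using complex_of_rat_Reals Reals_diff by blast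
    then show False using t(2) by (simp add: y_def)
  qed
  define s where "s = p + q\<^sup>2 / 4"
  have ys: "y\<^sup>2 = of_rat s"
  proof -
    have "y\<^sup>2 = t * t - of_rat q * t + (of_rat q)\<^sup>2 / 4"
      by (simp add: y_def power2_eq_square of_rat_divide of_rat_minus field_simps)
    then show ?thesis
      by (simp add: pq s_def of_rat_add of_rat_divide of_rat_power)
  qed
  obtain a b where ab: "s = Fract a b" "b > 0" by (cases s)
  have s: "of_rat s = complex_of_int a / of_int b" using ab by (simp add: of_rat_rat)
  have "y\<^sup>2 = of_real (of_int a / of_int b)" by (simp add: ys s)
  have "a < 0"
  proof (rule ccontr)
    assume "\<not> a < 0"
    then have "y\<^sup>2 = (of_real (sqrt (of_int a / of_int b)))\<^sup>2"
      using ab \<open>y\<^sup>2 = of_real (of_int a / of_int b)\<close> by (simp flip: of_real_power)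
    then have "y \<in> \<real>" by (auto simp: power2_eq_iff)
    then show False using \<open>y \<notin> \<real>\<close> by simp
  qed
  have "(of_int b * y)\<^sup>2 = - of_nat (nat (- a * b))"
  proof -
    have "(of_int b * y)\<^sup>2 = of_int (a * b)"
    proof -
      have "(of_int b * y)\<^sup>2 = (of_int b)\<^sup>2 * (of_int a / of_int b)"
        by (simp only: power_mult_distrib ys s)
      then show ?thesis using ab(2) by (simp add: power2_eq_square)
    qed
    also have "\<dots> = - of_int (- a * b)" by simp
    also have "of_int (- a * b) = complex_of_nat (nat (- a * b))"
      using ab \<open>a < 0\<close> by (intro of_nat_nat [symmetric]) (simp add: mult_le_0_iff)
    finally show ?thesis .
  qed
  moreover have "of_int b * y \<in> K"
    using complex_subfield_combination[OF sub yK, of 0 "of_int b"] by simp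
  moreover have "nat (- a * b) > 0" using ab \<open>a < 0\<close> by (simp add: mult_neg_pos)
  ultimately show ?thesis by metis
qed

text \<open>The classical generator is \<open>\<surd>-d\<close>, or
  \<open>(1 + \<surd>-d) / 2\<close> if \<open>d\<close> is 3 modulo 4. Integrality of trace and
  norm brings an integer of the field to the form \<open>(a + y x) / 2\<close> with
  \<open>a\<^sup>2 + d y\<^sup>2\<close> divisible by 4, and parity decides the rest.\<close>

lemma ring_of_integers_imaginary_quadratic:
  assumes K: "imaginary_quadratic_field K"
  shows "\<exists>w. 0 < Im w \<and> w * w \<in> ring_of_integers K \<and> ring_of_integers K = int_span2 1 w"
proof -
  have sub: "complex_subfield K" using K by (simp add: imaginary_quadratic_field_def)
  \<comment> \<open>Minimality of \<open>d\<close> among the positive integers with \<open>\<surd>-d \<in> K\<close> makes it squarefree.\<close>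
  define P where "P d \<longleftrightarrow> d > 0 \<and> (\<exists>x\<in>K. x\<^sup>2 = - complex_of_nat d)" for d :: nat
  define d where "d = (LEAST d. P d)"
  have "\<exists>d. P d" using imaginary_quadratic_field_sqrt[OF K] by (auto simp: P_def)
  then have Pd: "P d" and min: "\<And>e. P e \<Longrightarrow> d \<le> e"
    unfolding d_def by (auto intro: LeastI_ex Least_le)
  have d0: "d > 0" using Pd by (simp add: P_def)
  obtain x0 where x0: "x0 \<in> K" "x0\<^sup>2 = - complex_of_nat d" using Pd by (auto simp: P_def)
  define x where "x = \<i> * complex_of_real (sqrt (real d))"
  have xsq: "x\<^sup>2 = - complex_of_nat d"
    using d0 by (simp add: x_def power_mult_distrib flip: of_real_power)
  have xK: "x \<in> K"
  proof -
    have "x0\<^sup>2 = x\<^sup>2" using x0 xsq by simp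
    then have "x = x0 \<or> x = - x0" by (auto simp: power2_eq_iff)
    moreover have "- x0 \<in> K"
      using complex_subfield_combination[OF sub x0(1), of 0 "-1"] by (simp add: of_rat_minus)
    ultimately show ?thesis using x0 by auto
  qed
  have Im_x: "Im x = sqrt (real d)" and Re_x: "Re x = 0" by (simp_all add: x_def)
  have xR: "x \<notin> \<real>" using d0 Im_x by (simp add: complex_is_Real_iff)

  have sq_dvd: "e = 1" if e: "e > 0" "e\<^sup>2 dvd d" for e
  proof -
    obtain d' where d': "d = e\<^sup>2 * d'" using e(2) by (elim dvdE)
    have "x / of_nat e \<in> K"
      using complex_subfield_combination[OF sub xK, of 0 "1 / of_nat e"]
          by (simp add: of_rat_divide)
    moreover have "(x / of_nat e)\<^sup>2 = - of_nat d'"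
      using xsq d' e by (simp add: power_divide)
    moreover have "d' > 0" using d0 d' by (cases d') auto
    ultimately have "d \<le> d'" by (intro min) (auto simp: P_def)
    then have "e\<^sup>2 \<le> 1" using d' \<open>d' > 0\<close> by simp
    then show "e = 1" using e(1) self_le_power[of e 2] by linarith
  qed
  \<comment> \<open>In lowest terms the squared denominator divides the squarefree
    \<open>d\<close>.\<close>
  have rat_int: "y \<in> \<int>" if y: "of_nat d * y\<^sup>2 \<in> \<int>" for y :: rat
  proof -
    obtain r s where rs: "y = Fract r s" "s > 0" "coprime r s" by (cases y)
    obtain k where "of_nat d * y\<^sup>2 = of_int k" using y by (auto elim: Ints_cases)
    then have "of_int (int d * r\<^sup>2) = (of_int (k * s\<^sup>2) :: rat)"
      using rs by (simp add: Fract_of_int_quotient field_simps)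
    then have "int d * r\<^sup>2 = k * s\<^sup>2" by (simp only: of_int_eq_iff)
    then have "s\<^sup>2 dvd int d * r\<^sup>2" by simp
    then have "s\<^sup>2 dvd int d"
      using rs(3) by (simp add: coprime_dvd_mult_left_iff coprime_commute)
    then have "int ((nat s)\<^sup>2) dvd int d" using rs(2) by simp
    then have "(nat s)\<^sup>2 dvd d" by (simp only: of_nat_dvd_iff)
    then have "nat s = 1" using sq_dvd rs(2) by simp
    then have "s = 1" by simp
    then show "y \<in> \<int>" using rs by (simp add: Fract_of_int_quotient)
  qed
  have Ints_of_rat: "q \<in> \<int>" if "complex_of_rat q \<in> \<int>" for q
    using that by (metis Ints_cases Ints_of_int of_rat_eq_iff of_rat_of_int_eq)
  have coords: "\<exists>a y n :: int. z = (of_int a + of_int y * x) / 2 \<and> a\<^sup>2 + int d * y\<^sup>2 = 4 * n"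
    if z: "z \<in> ring_of_integers K" for z
  proof -
    have zK: "z \<in> K" "algebraic_int z" using z by (auto simp: ring_of_integers_def)
    obtain p q where pq: "z = of_rat p + of_rat q * x"
      using imaginary_quadratic_field_basis[OF K xK xR zK(1)] by blast
    \<comment> \<open>Trace and norm of \<open>z\<close>. Rational \<open>z\<close> is treated apart
      because the criterion for quadratic integers needs a non-real root.\<close>
    define t n where "t = 2 * p" and "n = p\<^sup>2 + of_nat d * q\<^sup>2"
    have tn: "t \<in> \<int> \<and> n \<in> \<int>"
    proof (cases "q = 0")
      case True
      then have "complex_of_rat p \<in> \<int>" using zK(2) pq by (intro rational_algebraic_int_is_int) auto
      then have "p \<in> \<int>" by (rule Ints_of_rat)
      then show ?thesis using True by (simp add: t_def n_def)
    next
      case False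
      have "z \<notin> \<real>"
      proof
        assume "z \<in> \<real>"
        then have "(z - of_rat p) / of_rat q \<in> \<real>"
            by (intro Reals_divide Reals_diff complex_of_rat_Reals)
        then show False using False xR by (simp add: pq)
      qed
      moreover have "z\<^sup>2 - of_rat t * z + of_rat n = (of_rat q)\<^sup>2 * (x\<^sup>2 + of_nat d)"
        by (simp add: pq t_def n_def of_rat_add of_rat_mult of_rat_power power2_eq_square
            algebra_simps)
      then have "z\<^sup>2 - of_rat t * z + of_rat n = 0" using xsq by simp
      ultimately have "complex_of_rat t \<in> \<int> \<and> complex_of_rat n \<in> \<int>"
        using algebraic_int_quadratic_Ints[OF zK(2), of "of_rat t" "of_rat n"] by simp
      then show ?thesis using Ints_of_rat by blast
    qed
    then obtain a n' where a: "t = of_int a" "n = of_int n'" by (auto elim!: Ints_cases)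
    \<comment> \<open>The negated discriminant of \<open>z\<close>: it makes \<open>2 * q\<close>
      integral, though \<open>q\<close> may be half an odd integer.\<close>
    have "of_nat d * (2 * q)\<^sup>2 = 4 * n - t\<^sup>2" by (simp add: t_def n_def power2_eq_square)
    also have "\<dots> \<in> \<int>" using a by simp
    finally have "2 * q \<in> \<int>" by (rule rat_int)
    then obtain y where y: "2 * q = of_int y" by (rule Ints_cases)
    have "rat_of_int (a\<^sup>2 + int d * y\<^sup>2) = (of_int a)\<^sup>2 + of_nat d * (of_int y)\<^sup>2" by simp
    also have "\<dots> = t\<^sup>2 + of_nat d * (2 * q)\<^sup>2" by (simp only: a(1) y)
    also have "\<dots> = 4 * n" by (simp add: t_def n_def power_mult_distrib)
    also have "\<dots> = of_int (4 * n')" by (simp add: a(2))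
    finally have "rat_of_int (a\<^sup>2 + int d * y\<^sup>2) = of_int (4 * n')" .
    then have "a\<^sup>2 + int d * y\<^sup>2 = 4 * n'" by (simp only: of_int_eq_iff)
    moreover have "z = (of_int a + of_int y * x) / 2"
    proof -
      have "p = of_int a / 2" "q = of_int y / 2" using a(1) y by (simp_all add: t_def)
      then have "complex_of_rat p = of_int a / 2" "complex_of_rat q = of_int y / 2"
        by (simp_all only: of_rat_divide of_rat_of_int_eq of_rat_numeral_eq)
      then show ?thesis by (simp only: pq add_divide_distrib times_divide_eq_left)
    qed
    ultimately show ?thesis by blast
  qed
  have combination: "of_int m + of_int k * w \<in> ring_of_integers K"
    if "w \<in> K" "w\<^sup>2 = of_int T * w - of_int N" for w T N m k
    using complex_subfield_combination[OF sub that(1), of "of_int m" "of_int k"]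
      algebraic_int_int_combination[OF that(2)] by (simp add: ring_of_integers_def)
  have result: ?thesis
    if "w \<in> K" "w\<^sup>2 = of_int T * w - of_int N" "Im w > 0" "ring_of_integers K \<subseteq> int_span2 1 w"
        for w T N
  proof (intro exI conjI)
    show "ring_of_integers K = int_span2 1 w"
      using that(4) combination[OF that(1,2)] by (auto simp: int_span2_def)
    show "w * w \<in> ring_of_integers K"
      using combination[OF that(1,2), of "- N" T] that(2) by (simp add: power2_eq_square)
  qed fact
  show ?thesis
  proof (cases "d mod 4 = 3")
    case True
    define w where "w = (1 + x) / 2"
    define N where "N = (1 + int d) div 4"
    have N: "1 + int d = 4 * N" using True unfolding N_def by presburger
    have "w \<in> K" using complex_subfield_combination[OF sub xK, of "1/2" "1/2"]
      by (simp add: w_def of_rat_divide add_divide_distrib)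
    moreover have "w\<^sup>2 = of_int 1 * w - of_int N"
    proof -
      have "w\<^sup>2 - w = (x\<^sup>2 - 1) / 4" by (simp add: w_def power2_eq_square field_simps)
      also have "\<dots> = - (of_int (1 + int d)) / 4" using xsq by simp
      also have "\<dots> = - of_int N" unfolding N by simp
      finally show ?thesis by (simp add: algebra_simps)
    qed
    moreover have "Im w > 0" using d0 by (simp add: w_def Im_x)
    moreover have "z \<in> int_span2 1 w" if zO: "z \<in> ring_of_integers K" for z
    proof -
      obtain a y n where z: "z = (of_int a + of_int y * x) / 2" and n: "a\<^sup>2 + int d * y\<^sup>2 = 4 * n"
        using coords[OF zO] by blast
      have "odd d" using True by presburger
      have "even (a\<^sup>2 + int d * y\<^sup>2)" using n by simp
      then have "even (a - y)" using \<open>odd d\<close> by simp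
      then obtain k where "a = 2 * k + y" by (metis diff_eq_eq evenE)
      then have "z = of_int k * 1 + of_int y * w" by (simp add: z w_def field_simps)
      then show ?thesis unfolding int_span2_def by blast
    qed
    ultimately show ?thesis using result by blast
  next
    case False
    have "\<not> 2\<^sup>2 dvd d" using sq_dvd[of 2] by auto
    then have d12: "d mod 4 = 1 \<or> d mod 4 = 2" using False by (simp add: dvd_eq_mod_eq_0) presburger
    have "x\<^sup>2 = of_int 0 * x - of_int (int d)" using xsq by simp
    moreover have "Im x > 0" using d0 by (simp add: Im_x)
    moreover have "z \<in> int_span2 1 x" if zO: "z \<in> ring_of_integers K" for z
    proof -
      obtain a y n where z: "z = (of_int a + of_int y * x) / 2" and n: "a\<^sup>2 + int d * y\<^sup>2 = 4 * n"
        using coords[OF zO] by blast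
      \<comment> \<open>Squares are 0 or 1 modulo 4 and \<open>d\<close> is 1 or 2, so the sum
        vanishes modulo 4 only if \<open>a\<close> and \<open>y\<close> are both even.\<close>
      have sq: "(even k \<longrightarrow> k\<^sup>2 mod 4 = 0) \<and> (odd k \<longrightarrow> k\<^sup>2 mod 4 = 1)" for k :: int
      proof (cases "even k")
        case True
        then obtain j where "k = 2 * j" by (rule evenE)
        then show ?thesis by (simp add: power_mult_distrib)
      next
        case False
        then obtain j where "k = 2 * j + 1" by (rule oddE)
        then have "k\<^sup>2 = 1 + (j\<^sup>2 + j) * 4" by (simp add: power2_eq_square algebra_simps)
        then show ?thesis using False by (simp only: mod_mult_self1) simp
      qed
      have d12': "int d mod 4 = 1 \<or> int d mod 4 = 2" using d12 by presburger
      have "(a\<^sup>2 mod 4 + (int d mod 4) * (y\<^sup>2 mod 4)) mod 4 =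
          (a\<^sup>2 mod 4 + ((int d mod 4) * (y\<^sup>2 mod 4)) mod 4) mod 4" by (simp only: mod_add_right_eq)
      also have "\<dots> = (a\<^sup>2 + int d * y\<^sup>2) mod 4" by (simp only: mod_mult_eq mod_add_eq)
      also have "\<dots> = 0" by (simp add: n)
      finally have "(a\<^sup>2 mod 4 + (int d mod 4) * (y\<^sup>2 mod 4)) mod 4 = 0" .
      then have "even a \<and> even y" using sq[of a] sq[of y] d12'
          by (cases "even a"; cases "even y") auto
      then obtain k l where "a = 2 * k" "y = 2 * l" by (auto elim!: evenE)
      then have "z = of_int k * 1 + of_int l * x" by (simp add: z)
      then show ?thesis unfolding int_span2_def by blast
    qed
    ultimately show ?thesis using result xK by blast
  qed
qed

text \<open>The \<open>THE\<close> needs uniqueness: two bases of one lattice are related by integer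
  matrices whose determinants multiply to 1, so the area form \<open>W\<close> changes at most its
  sign, which the square forgets.\<close>

lemma field_discriminant_eq:
  assumes R: "ring_of_integers K = int_span2 1 w" and "Im w > 0"
    and D: "real_of_int D = - (2 * Im w)\<^sup>2"
  shows "field_discriminant K = D"
  unfolding field_discriminant_def
proof (rule the_equality)
  have "complex_of_int D = of_real (of_int D)" by simp
  also have "\<dots> = (1 * cnj w - w * cnj 1)\<^sup>2"
    unfolding D by (simp add: complex_eq_iff power2_eq_square)
  finally show "\<exists>v u. ring_of_integers K = int_span2 v u \<and> of_int D = (v * cnj u - u * cnj v)\<^sup>2"
    using R by blast
next
  fix D'
  assume "\<exists>v u. ring_of_integers K = int_span2 v u \<and> of_int D' = (v * cnj u - u * cnj v)\<^sup>2"
  then obtain v u where vu: "int_span2 1 w = int_span2 v u"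
    and D': "of_int D' = (v * cnj u - u * cnj v)\<^sup>2" using R by auto
  have gen: "x \<in> int_span2 x y \<and> y \<in> int_span2 x y" for x y
    unfolding int_span2_def by (force intro: exI[of _ 0] exI[of _ 1])
  define W where "W x y = Im (cnj x * y)" for x y
  have W: "W (of_int a * x + of_int b * y) (of_int c * x + of_int e * y)
      = of_int (a * e - b * c) * W x y"
    for a b c e :: int and x y by (simp add: W_def algebra_simps)
  obtain a b c e where 1: "v = of_int a * 1 + of_int b * w" "u = of_int c * 1 + of_int e * w"
    using gen[of v u] unfolding vu[symmetric] unfolding int_span2_def by blast
  obtain a' b' c' e' where 2: "1 = of_int a' * v + of_int b' * u" "w
      = of_int c' * v + of_int e' * u"
    using gen[of 1 w] unfolding vu unfolding int_span2_def by blast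
  have "W 1 w = of_int (a' * e' - b' * c') * W v u" by (subst 2, subst 2) (rule W)
  moreover have vu1: "W v u = of_int (a * e - b * c) * W 1 w" unfolding 1 by (rule W)
  moreover have "W 1 w \<noteq> 0" using \<open>Im w > 0\<close> by (simp add: W_def)
  ultimately have "of_int ((a' * e' - b' * c') * (a * e - b * c)) = (1 :: real)" by simp
  then have "(a' * e' - b' * c') * (a * e - b * c) = 1" by (simp only: of_int_eq_1_iff)
  then have "\<bar>a * e - b * c\<bar> = 1" by (metis abs_mult_pos' zmult_eq_1_iff abs_1 abs_minus_cancel)
  then have "\<bar>W v u\<bar> = \<bar>W 1 w\<bar>" unfolding vu1 abs_mult by (metis mult_1 of_int_1 of_int_abs)
  have "(v * cnj u - u * cnj v)\<^sup>2 = - of_real ((2 * W v u)\<^sup>2)"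
    by (simp add: W_def complex_eq_iff power2_eq_square algebra_simps)
  then have "of_int D' = complex_of_real (- (2 * W v u)\<^sup>2)" using D' by simp
  then have "real_of_int D' = - (2 * W v u)\<^sup>2" by (metis of_real_of_int_eq of_real_eq_iff)
  also have "\<dots> = - (2 * W 1 w)\<^sup>2"
    using \<open>\<bar>W v u\<bar> = \<bar>W 1 w\<bar>\<close> by (metis power2_abs power_mult_distrib)
  also have "\<dots> = of_int D" by (simp add: D W_def)
  finally show "D' = D" by simp
qed


section \<open>Moebius images of the real line\<close>

definition mat2 :: "complex \<Rightarrow> complex \<Rightarrow> complex \<Rightarrow> complex \<Rightarrow> complex^2^2" where
  "mat2 a b c d = vector [vector [a, b], vector [c, d]]"

lemma mat2_nth [simp]:
  "mat2 a b c d $ 1 $ 1 = a" "mat2 a b c d $ 1 $ 2 = b"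
  "mat2 a b c d $ 2 $ 1 = c" "mat2 a b c d $ 2 $ 2 = d"
  by (simp_all add: mat2_def)

lemma mat2_cases: obtains a b c d where "M = mat2 a b c d"
proof
  show "M = mat2 (M$1$1) (M$1$2) (M$2$1) (M$2$2)"
    by (simp add: vec_eq_iff forall_2)
qed

lemma mat2_mult:
  "mat2 a b c d ** mat2 a' b' c' d' =
     mat2 (a * a' + b * c') (a * b' + b * d') (c * a' + d * c') (c * b' + d * d')"
  by (simp add: vec_eq_iff forall_2 matrix_matrix_mult_def sum_2)

lemma det_mat2 [simp]: "det (mat2 a b c d) = a * d - b * c"
  by (simp add: det_2)

lemma mat2_one: "mat2 1 0 0 1 = mat 1"
  by (simp add: vec_eq_iff forall_2 mat_def)

text \<open>Homogeneous coordinates \<open>[x : y]\<close>, in which \<open>moebius\<close> is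
  linear and poles need no separate case. The value at \<open>(0, 0)\<close> is meaningless, hence
  the conditions \<open>x \<noteq> 0 \<or> y \<noteq> 0\<close>.\<close>

definition hpoint :: "complex \<Rightarrow> complex \<Rightarrow> complex option" where
  "hpoint x y = (if y = 0 then None else Some (x / y))"

lemma hpoint_cases: obtains x y where "p = hpoint x y" "x \<noteq> 0 \<or> y \<noteq> 0"
proof (cases p)
  case None
  then show thesis using that[of 1 0] by (simp add: hpoint_def)
next
  case (Some z)
  then show thesis using that[of z 1] by (simp add: hpoint_def)
qed

lemma moebius_hpoint:
  assumes "x \<noteq> 0 \<or> y \<noteq> 0"
  shows "moebius (mat2 a b c d) (hpoint x y) = hpoint (a * x + b * y) (c * x + d * y)"
proof (cases "y = 0")
  case False
  have "c * (x / y) + d = (c * x + d * y) / y" "a * (x / y) + b = (a * x + b * y) / y"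
    using False by (simp_all add: field_simps)
  then show ?thesis using False by (simp add: moebius_def hpoint_def)
qed (use assms in \<open>auto simp: moebius_def hpoint_def\<close>)

text \<open>Invertibility of \<open>N\<close> keeps the intermediate homogeneous vector away from
  \<open>(0, 0)\<close>.\<close>

lemma moebius_mult:
  assumes "det N \<noteq> 0"
  shows "moebius (M ** N) p = moebius M (moebius N p)"
proof -
  obtain a b c d where M: "M = mat2 a b c d" by (rule mat2_cases)
  obtain a' b' c' d' where N: "N = mat2 a' b' c' d'" by (rule mat2_cases)
  obtain x y where p: "p = hpoint x y" "x \<noteq> 0 \<or> y \<noteq> 0" by (rule hpoint_cases)
  have "a' * x + b' * y \<noteq> 0 \<or> c' * x + d' * y \<noteq> 0"
  proof (rule ccontr)
    assume "\<not> ?thesis"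
    then have *: "a' * x + b' * y = 0" "c' * x + d' * y = 0" by auto
    have "(a' * d' - b' * c') * x = d' * (a' * x + b' * y) - b' * (c' * x + d' * y)"
      "(a' * d' - b' * c') * y = a' * (c' * x + d' * y) - c' * (a' * x + b' * y)"
      by (simp_all add: algebra_simps)
    then show False using assms p(2) * by (simp add: N)
  qed
  then show ?thesis
    using p by (simp add: M N mat2_mult moebius_hpoint algebra_simps)
qed

lemma moebius_one [simp]: "moebius (mat 1) p = p"
  by (cases p) (simp_all add: moebius_def flip: mat2_one)

lemma moebius_inverse:
  assumes "M ** N = mat 1"
  shows "moebius M (moebius N p) = p"
proof -
  have "det M * det N = 1" by (metis assms det_I det_mul)
  then have "det N \<noteq> 0" by auto
  then show ?thesis using moebius_mult[of N M p] assms by simp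
qed

lemma bij_moebius:
  assumes "det M \<noteq> 0"
  shows "bij (moebius M)"
proof -
  obtain N where "M ** N = mat 1" "N ** M = mat 1"
    using assms by (auto simp: invertible_det_nz[symmetric] invertible_def)
  then show ?thesis by (intro o_bij[of "moebius N"]) (auto simp: fun_eq_iff moebius_inverse)
qed

lemma moebius_ocircle_mult:
  assumes "det N \<noteq> 0"
  shows "moebius_ocircle (M ** N) C = moebius_ocircle M (moebius_ocircle N C)"
  using moebius_mult[OF assms] by (simp add: moebius_ocircle_def image_image)

lemma moebius_ocircle_sel [simp]:
  "underlying (moebius_ocircle M C) = moebius M ` underlying C"
  "ointerior (moebius_ocircle M C) = moebius M ` ointerior C"
  by (simp_all add: moebius_ocircle_def)

lemma oexterior_moebius_ocircle:
  "det M \<noteq> 0 \<Longrightarrow> oexterior (moebius_ocircle M C) = moebius M ` oexterior C"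
  by (metis bij_image_Compl_eq bij_moebius image_Un moebius_ocircle_sel oexterior_def)

lemma externally_tangent_moebius_ocircle:
  assumes "det M \<noteq> 0"
  shows "externally_tangent (moebius_ocircle M C) (moebius_ocircle M C') \<longleftrightarrow> externally_tangent C C'"
proof -
  have inj: "inj (moebius M)"
    using bij_moebius[OF assms] by (auto simp: bij_def)
  have "card (moebius M ` A) = card A" for A
    using inj by (intro card_image) (auto intro: inj_on_subset)
  then have "(\<exists>z. moebius M ` A = {z}) \<longleftrightarrow> (\<exists>z. A = {z})" for A
    by (metis card_1_singleton_iff)
  then show ?thesis
    using inj by (simp add: externally_tangent_def flip: image_Int)
qed

lemma straddles_moebius_ocircle:
  assumes "det M \<noteq> 0"
  shows "straddles ((`) (moebius M) ` P) (moebius_ocircle M D) \<longleftrightarrow> straddles P D"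
proof -
  have inj: "inj (moebius M)" using bij_moebius[OF assms] by (auto simp: bij_def)
  show ?thesis
    unfolding straddles_def oexterior_moebius_ocircle[OF assms] moebius_ocircle_sel
    using inj by (simp add: inj_image_eq_iff flip: image_Int)
qed

lemma underlying_real_circle: "underlying real_circle = insert None (Some ` \<real>)"
  and ointerior_real_circle: "ointerior real_circle = Some ` {z. Im z > 0}"
  by (auto simp: real_circle_def directed_line_def Reals_def image_def)

text \<open>The sign of \<open>Im (M\<^sup>-\<^sup>1 z)\<close>, with denominators cleared so that it is a Hermitian form in \<open>z\<close>.\<close>

definition side :: "complex^2^2 \<Rightarrow> complex \<Rightarrow> real" where
  "side M z = Im ((M$2$2 * z - M$1$2) * cnj (M$1$1 - M$2$1 * z))"

lemma Im_divide_sgn: "y \<noteq> 0 \<Longrightarrow> Im (x / y) > 0 \<longleftrightarrow> Im (x * cnj y) > 0"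
  "y \<noteq> 0 \<Longrightarrow> Im (x / y) = 0 \<longleftrightarrow> Im (x * cnj y) = 0"
  by (simp_all add: complex_div_cnj[of x y] Im_divide_of_real zero_less_divide_iff)

lemma moebius_real_circle_iff:
  assumes "det M \<noteq> 0"
  shows "None \<in> moebius M ` underlying real_circle \<longleftrightarrow> Im (cnj (M$2$1) * M$2$2) = 0"
    and "None \<in> moebius M ` ointerior real_circle \<longleftrightarrow> Im (cnj (M$2$1) * M$2$2) < 0"
    and "Some z \<in> moebius M ` underlying real_circle \<longleftrightarrow> side M z = 0"
    and "Some z \<in> moebius M ` ointerior real_circle \<longleftrightarrow> side M z > 0"
proof -
  obtain a b c d where M: "M = mat2 a b c d" by (rule mat2_cases)
  \<comment> \<open>The adjugate inverts \<open>M\<close> up to the scalar \<open>det M\<close>,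
    which acts trivially on the sphere, so membership in the image is tested by \<open>A\<close>
    without dividing by the determinant.\<close>
  define A where "A = mat2 d (- b) (- c) a"
  have det: "a * d - b * c \<noteq> 0" using assms by (simp add: M)
  have inv: "moebius A (moebius M p) = p \<and> moebius M (moebius A p) = p" for p
  proof -
    obtain x y where p: "p = hpoint x y" "x \<noteq> 0 \<or> y \<noteq> 0" by (rule hpoint_cases)
    have "det A \<noteq> 0" using det by (simp add: A_def algebra_simps)
    have "hpoint (u * x) (u * y) = hpoint x y" if "u \<noteq> 0" for u
      using that by (simp add: hpoint_def)
    from this[OF det] show ?thesis
      using p det \<open>det A \<noteq> 0\<close> assms
          unfolding moebius_mult[OF assms, symmetric] moebius_mult[OF \<open>det A \<noteq> 0\<close>, symmetric]
      by (simp add: M A_def mat2_mult moebius_hpoint algebra_simps)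
  qed
  then have mem: "p \<in> moebius M ` S \<longleftrightarrow> moebius A p \<in> S" for p S
    by (metis image_iff)
  show "None \<in> moebius M ` underlying real_circle \<longleftrightarrow> Im (cnj (M$2$1) * M$2$2) = 0"
    "None \<in> moebius M ` ointerior real_circle \<longleftrightarrow> Im (cnj (M$2$1) * M$2$2) < 0"
    using Im_divide_sgn[of "- c" d] unfolding mem underlying_real_circle ointerior_real_circle
    by (auto simp: A_def M moebius_def complex_is_Real_iff mult.commute)
  show "Some z \<in> moebius M ` underlying real_circle \<longleftrightarrow> side M z = 0"
    "Some z \<in> moebius M ` ointerior real_circle \<longleftrightarrow> side M z > 0"
    using Im_divide_sgn[of "a - c * z" "d * z - b"] 
    unfolding mem underlying_real_circle ointerior_real_circle
    by (auto simp: A_def M side_def moebius_def complex_is_Real_iff)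
qed

lemma
  assumes "r > 0"
  shows curvature_ccw_circle: "curvature (ccw_circle c r) = 1 / r"
    and curvature_cw_circle: "curvature (cw_circle c r) = - (1 / r)"
proof -
  \<comment> \<open>Infinity is interior to a clockwise circle but not to a counterclockwise one, so
    the sign of the curvature is well defined.\<close>
  have ne: "ccw_circle x s \<noteq> cw_circle y t" for x y s t
  proof -
    have "None \<in> ointerior (cw_circle y t)" "None \<notin> ointerior (ccw_circle x s)"
      by (auto simp: ccw_circle_def cw_circle_def)
    then show ?thesis by metis
  qed
  have inj: "Some ` A = Some ` B \<longleftrightarrow> A = B" for A B :: "complex set"
    by (simp add: inj_image_eq_iff)
  have ccw: "r' = r" if "ccw_circle c r = ccw_circle c' r'" "r' > 0" for c' r'
    using that assms by (simp add: ccw_circle_def inj ball_eq_ball_iff)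
  have cw: "r' = r" if "cw_circle c r = cw_circle c' r'" "r' > 0" for c' r'
    using that assms by (simp add: cw_circle_def inj cball_eq_cball_iff)
  have None: "None \<notin> underlying (ccw_circle c r)" "None \<notin> underlying (cw_circle c r)"
    by (auto simp: ccw_circle_def cw_circle_def)
  have "(THE k. \<exists>x s. s > 0 \<and> (ccw_circle c r = ccw_circle x s \<and> k = 1 / s \<or>
      ccw_circle c r = cw_circle x s \<and> k = - (1 / s))) = 1 / r"
    by (rule the_equality) (use assms in blast, metis ne ccw)
  then show "curvature (ccw_circle c r) = 1 / r" using None(1)
      by (simp only: curvature_def if_False)
  have "(THE k. \<exists>x s. s > 0 \<and> (cw_circle c r = ccw_circle x s \<and> k = 1 / s \<or>
      cw_circle c r = cw_circle x s \<and> k = - (1 / s))) = - (1 / r)"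
    by (rule the_equality) (use assms in blast, metis ne cw)
  then show "curvature (cw_circle c r) = - (1 / r)" using None(2)
      by (simp only: curvature_def if_False)
qed

section \<open>Images of the real line as oriented circles\<close>

lemma directed_line_iff:
  assumes "u \<noteq> 0"
  shows "Some z \<in> underlying (directed_line p u) \<longleftrightarrow> Im ((z - p) / u) = 0"
    and "Some z \<in> ointerior (directed_line p u) \<longleftrightarrow> Im ((z - p) / u) > 0"
    and "None \<in> underlying (directed_line p u)" and "None \<notin> ointerior (directed_line p u)"
proof -
  have "(\<exists>t. z = p + of_real t * u) \<longleftrightarrow> (z - p) / u \<in> \<real>"
    using assms by (auto simp: Reals_def field_simps)
  then show "Some z \<in> underlying (directed_line p u) \<longleftrightarrow> Im ((z - p) / u) = 0"
    by (auto simp: directed_line_def complex_is_Real_iff)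
qed (auto simp: directed_line_def)

lemma ocircle_eqI:
  assumes "\<And>z. Some z \<in> underlying C \<longleftrightarrow> Some z \<in> underlying D"
    and "\<And>z. Some z \<in> ointerior C \<longleftrightarrow> Some z \<in> ointerior D"
    and "None \<in> underlying C \<longleftrightarrow> None \<in> underlying D"
    and "None \<in> ointerior C \<longleftrightarrow> None \<in> ointerior D"
  shows "C = D"
proof (rule ocircle.expand, rule conjI)
  show "underlying C = underlying D" using assms(1,3) by (intro set_eqI) (metis option.exhaust)
  show "ointerior C = ointerior D" using assms(2,4) by (intro set_eqI) (metis option.exhaust)
qed

text \<open>The form \<open>side M z = Im (B * z) - D - k |z|\<^sup>2\<close> has discriminant
  \<open>|B|\<^sup>2 - 4 k D = |det M|\<^sup>2 = 1\<close>. Hence it describes a line if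
  \<open>k = 0\<close> and otherwise a circle of radius \<open>1 / (2 |k|)\<close>; it is positive
  on the disc for \<open>k > 0\<close> and outside it for \<open>k < 0\<close>.\<close>

lemma moebius_ocircle_real_circle_oriented:
  assumes det: "cmod (det M) = 1"
  shows "oriented_circle (moebius_ocircle M real_circle)" (is "oriented_circle ?C")
    and "curvature (moebius_ocircle M real_circle) = 2 * Im (cnj (M$2$1) * M$2$2)"
proof -
  obtain a b c d where M: "M = mat2 a b c d" by (rule mat2_cases)
  define k where "k = Im (cnj c * d)"
  define B where "B = d * cnj a - cnj b * c"
  define D where "D = Im (b * cnj a)"
  have side: "side M z = Im (B * z) - D - k * (cmod z)\<^sup>2" for z
    unfolding side_def M B_def D_def k_def cmod_power2 by (simp add: power2_eq_square) algebra
  have disc: "(cmod B)\<^sup>2 - 4 * k * D = 1"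
  proof -
    have "(cmod B)\<^sup>2 - 4 * k * D = (cmod (det M))\<^sup>2"
      unfolding M B_def D_def k_def cmod_power2 by (simp add: power2_eq_square) algebra
    then show ?thesis using det by simp
  qed
  have "det M \<noteq> 0" using det by auto
  note iff = moebius_real_circle_iff[OF this, unfolded M mat2_nth, folded M k_def]
  \<comment> \<open>The centre \<open>i * cnj B / (2 k)\<close>, found by completing the
    square.\<close>
  define q where "q = Complex (Im B / (2 * k)) (Re B / (2 * k))"
  have circ: "side M z = k * (1 / (4 * k\<^sup>2) - (cmod (z - q))\<^sup>2)" if "k \<noteq> 0" for z
  proof -
    have "(cmod (z - q))\<^sup>2 = (cmod z)\<^sup>2 - Im (B * z) / k + (cmod B)\<^sup>2 / (4 * k\<^sup>2)"
      unfolding cmod_power2 q_def minus_complex.sel complex.sel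
      using that by (simp add: field_simps power2_eq_square)
    also have "(cmod B)\<^sup>2 = 1 + 4 * k * D" using disc by simp
    finally show ?thesis using that by (simp add: side power2_eq_square field_simps)
  qed
  have dist: "dist x z < r \<longleftrightarrow> (cmod (z - x))\<^sup>2 < r\<^sup>2" "dist x z = r \<longleftrightarrow> (cmod (z - x))\<^sup>2 = r\<^sup>2"
    "dist x z \<le> r \<longleftrightarrow> (cmod (z - x))\<^sup>2 \<le> r\<^sup>2" "r < cmod y \<longleftrightarrow> r\<^sup>2 < (cmod y)\<^sup>2"
    if "r > 0" for x y z r
    using that by (auto simp: dist_norm norm_minus_commute abs_le_square_iff[symmetric]
        abs_square_less_1 power2_eq_iff_nonneg intro: power_strict_mono power2_less_imp_less)
  consider "k = 0" | "k > 0" | "k < 0" by linarith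
  then show "oriented_circle ?C" "curvature ?C = 2 * Im (cnj (M$2$1) * M$2$2)"
  proof (atomize(full), cases)
    case 1
    then have "B \<noteq> 0" using disc by auto
    \<comment> \<open>The line \<open>Im (B * z) = D\<close> runs through \<open>i * D / B\<close>
      in direction \<open>1 / B\<close>.\<close>
    have "(z - \<i> * D / B) / (1 / B) = B * z - \<i> * D" for z
      using \<open>B \<noteq> 0\<close> by (simp add: field_simps)
    then have "?C = directed_line (\<i> * D / B) (1 / B)"
      using \<open>B \<noteq> 0\<close> 1 by (intro ocircle_eqI) (simp_all add: directed_line_iff iff side)
    moreover have "1 / B \<noteq> 0" using \<open>B \<noteq> 0\<close> by simp
    ultimately have "oriented_circle ?C" unfolding oriented_circle_def by blast
    moreover have "curvature ?C = 0" using iff(1) 1 by (simp add: curvature_def M)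
    ultimately show "oriented_circle ?C \<and> curvature ?C = 2 * Im (cnj (M$2$1) * M$2$2)"
      unfolding M mat2_nth k_def[symmetric] using 1 by simp
  next
    case 2
    define r where "r = 1 / (2 * k)"
    have "r > 0" "1 / (4 * k\<^sup>2) = r\<^sup>2" using 2
        by (simp_all add: r_def power_divide power_mult_distrib)
    then have C: "?C = ccw_circle (q) r"
      using 2 by (intro ocircle_eqI)
        (auto simp: ccw_circle_def iff circ dist zero_less_mult_iff inj_image_mem_iff)
    then have "oriented_circle ?C" using \<open>r > 0\<close> unfolding oriented_circle_def by blast
    then show "oriented_circle ?C \<and> curvature ?C = 2 * Im (cnj (M$2$1) * M$2$2)"
      unfolding C unfolding M mat2_nth k_def[symmetric]
      using curvature_ccw_circle[OF \<open>r > 0\<close>] by (simp add: r_def)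
  next
    case 3
    define r where "r = - 1 / (2 * k)"
    have "r > 0" "1 / (4 * k\<^sup>2) = r\<^sup>2" using 3
        by (simp_all add: r_def power_divide power_mult_distrib)
    then have C: "?C = cw_circle (q) r"
      using 3 by (intro ocircle_eqI)
        (auto simp: cw_circle_def iff circ dist zero_less_mult_iff inj_image_mem_iff not_le)
    then have "oriented_circle ?C" using \<open>r > 0\<close> unfolding oriented_circle_def by blast
    then show "oriented_circle ?C \<and> curvature ?C = 2 * Im (cnj (M$2$1) * M$2$2)"
      unfolding C unfolding M mat2_nth k_def[symmetric]
      using curvature_cw_circle[OF \<open>r > 0\<close>] by (simp add: r_def)
  qed
qed

text \<open>If the centres differ, the line joining them meets the first sphere in two points at
  distances \<open>|e| + r\<close> and \<open>||e| - r|\<close> from the second centre, with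
  \<open>|e|\<close> the distance of the centres; these two numbers are never equal.\<close>

lemma sphere_eq_sphereD:
  fixes c c' :: complex
  assumes "sphere c r = sphere c' r'" and "r > 0" and "r' > 0"
  shows "c = c' \<and> r = r'"
proof -
  have "c = c'"
  proof (rule ccontr)
    assume "c \<noteq> c'"
    define e where "e = c - c'"
    have "e \<noteq> 0" using \<open>c \<noteq> c'\<close> by (simp add: e_def)
    have "c + of_real r * sgn e \<in> sphere c r" "c - of_real r * sgn e \<in> sphere c r"
      using \<open>e \<noteq> 0\<close> \<open>r > 0\<close> by (simp_all add: dist_norm norm_mult norm_sgn)
    then have "cmod (e + of_real r * sgn e) = r'" "cmod (e - of_real r * sgn e) = r'"
      unfolding assms(1) by (simp_all add: e_def dist_norm norm_minus_commute algebra_simps)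
    moreover have "e = of_real (cmod e) * sgn e"
      using \<open>e \<noteq> 0\<close> by (simp add: sgn_div_norm scaleR_conv_of_real)
    then have "e + of_real r * sgn e = of_real (cmod e + r) * sgn e"
      "e - of_real r * sgn e = of_real (cmod e - r) * sgn e"
      by (metis distrib_right of_real_add, metis left_diff_distrib of_real_diff)
    ultimately have "\<bar>cmod e + r\<bar> = \<bar>cmod e - r\<bar>"
      using \<open>e \<noteq> 0\<close> by (simp add: norm_mult norm_sgn del: of_real_add of_real_diff)
    then show False using \<open>e \<noteq> 0\<close> \<open>r > 0\<close> by (simp add: abs_if split: if_splits)
  qed
  moreover have "c + of_real r \<in> sphere c r" using \<open>r > 0\<close> by (simp add: dist_norm)
  then have "c + of_real r \<in> sphere c' r'" using assms(1) by blast
  ultimately show ?thesis using \<open>r > 0\<close> by (simp add: dist_norm)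
qed

text \<open>Two real affine functions with the same line as zero set are proportional, and the sign
  of the factor \<open>s\<close> tells whether the orientations agree. For a proper circle, centre
  and radius are determined, which leaves only the disc and its exterior.\<close>

lemma oriented_circle_underlying_eq:
  assumes "oriented_circle C" and "oriented_circle D" and "underlying C = underlying D"
  shows "ointerior D = ointerior C \<or> ointerior D = oexterior C"
proof (cases "None \<in> underlying C")
  case True
  then obtain p u p' u' where u: "u \<noteq> 0" "u' \<noteq> 0"
    and C: "C = directed_line p u" and D: "D = directed_line p' u'"
    using assms by (auto simp: oriented_circle_def ccw_circle_def cw_circle_def)
  define l where "l z = Im ((z - p) / u)" for z
  define l' where "l' z = Im ((z - p') / u')" for z
  have iff: "l z = 0 \<longleftrightarrow> l' z = 0" for z
    using directed_line_iff(1)[OF u(1), of z p] directed_line_iff(1)[OF u(2), of z p'] assms(3)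
    unfolding C D l_def l'_def by simp
  \<comment> \<open>Here \<open>l\<close> takes the value 1, so \<open>l'\<close> takes the factor
    of proportionality.\<close>
  define s where "s = l' (p + \<i> * u)"
  have p0: "l' p = 0" "l' (p + u) = 0" using u by (simp_all flip: iff add: l_def)
  have l': "l' z = s * l z" for z
  proof -
    have z: "z = p + of_real (Re ((z - p) / u)) * u + of_real (l z) * (\<i> * u)"
    proof -
      have "(z - p) / u = of_real (Re ((z - p) / u)) + of_real (l z) * \<i>"
        unfolding l_def by (simp add: complex_eq_iff)
      then have "z - p = (of_real (Re ((z - p) / u)) + of_real (l z) * \<i>) * u"
        using u by (metis nonzero_eq_divide_eq)
      then show ?thesis by (simp add: algebra_simps)
    qed
    have aff: "l' (p + of_real x * u + of_real y * (\<i> * u)) =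
        l' p + x * (l' (p + u) - l' p) + y * (l' (p + \<i> * u) - l' p)" for x y
    proof -
      have "(p + of_real x * u + of_real y * (\<i> * u) - p') / u' =
        (p - p') / u' + of_real x * ((p + u - p') / u' - (p - p') / u')
          + of_real y * ((p + \<i> * u - p') / u' - (p - p') / u')"
        using u by (simp add: field_simps)
      then show ?thesis unfolding l'_def
          by (simp only: plus_complex.sel minus_complex.sel Im_complex_of_real Re_complex_of_real
              times_complex.sel mult_zero_left diff_zero)
    qed
    show ?thesis by (subst z, subst aff) (simp add: p0 s_def)
  qed
  have "s \<noteq> 0"
  proof
    assume "s = 0"
    then have "l (p + \<i> * u) = 0" using iff l' by simp
    then show False using u by (simp add: l_def)
  qed
  have int: "p \<in> ointerior D \<longleftrightarrow> (\<exists>z. p = Some z \<and> l' z > 0)" "p \<in> ointerior C \<longleftrightarrow> (\<exists>z. p = Some z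
      \<and> l z > 0)"
    "p \<in> oexterior C \<longleftrightarrow> (\<exists>z. p = Some z \<and> l z < 0)" for p
    using directed_line_iff[OF u(1)] directed_line_iff[OF u(2)]
    by (cases p; force simp: C D l_def l'_def oexterior_def)+
  show ?thesis
  proof (cases "s > 0")
    case True
    then show ?thesis by (auto simp: int l' set_eq_iff zero_less_mult_iff)
  next
    case False
    then show ?thesis using \<open>s \<noteq> 0\<close>
      by (intro disjI2) (auto simp: int l' set_eq_iff zero_less_mult_iff)
  qed
next
  case False
  then obtain c r c' r' where r: "r > 0" "r' > 0"
    and C: "C = ccw_circle c r \<or> C = cw_circle c r" and D: "D = ccw_circle c' r' \<or> D
        = cw_circle c' r'"
    using assms by (auto simp: oriented_circle_def directed_line_def)
  then have "Some ` sphere c r = Some ` sphere c' r'"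
    using assms(3) by (auto simp: ccw_circle_def cw_circle_def)
  then have "c' = c" "r' = r" using sphere_eq_sphereD[OF _ r, of c c']
      by (simp_all add: inj_image_eq_iff)
  moreover have "Some ` cball c r = Some ` sphere c r \<union> Some ` ball c r"
    by (auto simp flip: image_Un)
  ultimately show ?thesis
    using C D by (auto simp: ccw_circle_def cw_circle_def oexterior_def)
qed

lemma real_circle_iff:
  "Some z \<in> underlying real_circle \<longleftrightarrow> Im z = 0" "Some z \<in> ointerior real_circle \<longleftrightarrow> Im z > 0"
  "None \<in> underlying real_circle" "None \<notin> ointerior real_circle"
  by (simp_all add: real_circle_def directed_line_iff)

text \<open>The map \<open>z \<mapsto> -z\<close> exchanges the half planes. Its determinant -1
  keeps it in \<open>GL2\<close>, so both orientations of a Bianchi circle come from matrices in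
  \<open>GL2\<close>.\<close>

abbreviation flip :: "complex^2^2" where "flip \<equiv> mat2 (-1) 0 0 1"

lemma moebius_flip: "moebius flip ` underlying real_circle = underlying real_circle"
  "moebius flip ` ointerior real_circle = oexterior real_circle"
proof -
  have inv: "moebius flip (moebius flip p) = p" for p
    by (rule moebius_inverse) (simp add: mat2_mult mat2_one)
  have mem: "p \<in> moebius flip ` S \<longleftrightarrow> moebius flip p \<in> S" for p S
    using image_eqI[of p "moebius flip" "moebius flip p" S] by (auto simp: inv)
  have flip: "moebius flip None = None" "moebius flip (Some z) = Some (- z)" for z
    by (simp_all add: moebius_def)
  have "moebius_ocircle flip real_circle = OCircle (underlying real_circle) (oexterior real_circle)"
    by (rule ocircle_eqI) (auto simp: mem flip oexterior_def real_circle_iff)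
  then show "moebius flip ` underlying real_circle = underlying real_circle"
    "moebius flip ` ointerior real_circle = oexterior real_circle"
    by (simp_all add: moebius_ocircle_def)
qed

lemma oriented_circle_cases:
  assumes "oriented_circle D" and "underlying D = moebius N ` underlying real_circle"
    and "cmod (det N) = 1"
  shows "D = moebius_ocircle N real_circle \<or> D = moebius_ocircle (N ** flip) real_circle"
proof -
  have "det N \<noteq> 0" using assms(3) by auto
  have "moebius_ocircle (N ** flip) real_circle
      = moebius_ocircle N (moebius_ocircle flip real_circle)"
    by (rule moebius_ocircle_mult) simp
  then have eq: "underlying (moebius_ocircle (N ** flip) real_circle) = underlying D"
    "ointerior (moebius_ocircle (N ** flip) real_circle)
        = oexterior (moebius_ocircle N real_circle)"
    by (simp_all add: moebius_flip assms(2) oexterior_moebius_ocircle[OF \<open>det N \<noteq> 0\<close>]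
        del: moebius_ocircle_sel add: moebius_ocircle_sel[of N] moebius_ocircle_sel[of flip])
  have "ointerior D = ointerior (moebius_ocircle N real_circle) \<or>
      ointerior D = oexterior (moebius_ocircle N real_circle)"
    by (rule oriented_circle_underlying_eq[OF moebius_ocircle_real_circle_oriented(1)[OF assms(3)]
        assms(1)])
       (simp add: assms(2))
  then show ?thesis
  proof
    assume "ointerior D = ointerior (moebius_ocircle N real_circle)"
    then show ?thesis by (intro disjI1 ocircle.expand) (simp add: assms(2))
  next
    assume "ointerior D = oexterior (moebius_ocircle N real_circle)"
    then show ?thesis by (intro disjI2 ocircle.expand conjI) (simp_all only: eq)
  qed
qed


section \<open>Bianchi circles\<close>

lemma GL2_mat2_iff:
  "mat2 a b c d \<in> GL2 R \<longleftrightarrow> {a, b, c, d} \<subseteq> R \<and> (\<exists>u\<in>R. (a * d - b * c) * u = 1)"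
  by (auto simp: GL2_def forall_2)

lemma SL2_mat2_iff: "mat2 a b c d \<in> SL2 R \<longleftrightarrow> {a, b, c, d} \<subseteq> R \<and> a * d - b * c = 1"
  by (auto simp: SL2_def forall_2)

lemma SL2_Ints_E:
  assumes "S \<in> SL2 \<int>"
  obtains m p n q :: int where "S = mat2 (of_int m) (of_int p) (of_int n) (of_int q)" "m * q - p * n
      = 1"
proof -
  obtain a b c d where S: "S = mat2 a b c d" by (rule mat2_cases)
  have "a \<in> \<int>" "b \<in> \<int>" "c \<in> \<int>" "d \<in> \<int>" and det: "a * d - b * c = 1"
    using assms by (simp_all add: S SL2_mat2_iff)
  then obtain m p n q where int: "a = of_int m" "b = of_int p" "c = of_int n" "d = of_int q"
    by (metis Ints_cases)
  have "of_int (m * q - p * n) = (1 :: complex)" using det by (simp add: int)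
  then have "m * q - p * n = 1" by (simp only: of_int_eq_1_iff)
  then show thesis using that S int by blast
qed

text \<open>Bezout. Such a matrix sends infinity to the cusp \<open>m / n\<close>.\<close>

lemma SL2_Ints_column:
  assumes "coprime m (n :: int)"
  shows "\<exists>p q. mat2 (of_int m) (of_int p) (of_int n) (of_int q) \<in> SL2 \<int>"
proof -
  obtain u v where "u * m + v * n = 1" using bezout_int[of m n] assms
      by (auto simp: coprime_iff_gcd_eq_1)
  then have "of_int (m * u - (- v) * n) = (1 :: complex)" by (simp add: algebra_simps)
  then have "mat2 (of_int m) (of_int (- v)) (of_int n) (of_int u) \<in> SL2 \<int>"
    by (auto simp: SL2_mat2_iff)
  then show ?thesis by blast
qed

lemma SL2_Ints_one: "mat 1 \<in> SL2 \<int>"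
  unfolding mat2_one[symmetric] by (simp add: SL2_mat2_iff)

text \<open>Determinant 1 turns \<open>side S z\<close> into \<open>Im z\<close>. So
  \<open>M\<close> and \<open>M ** S\<close> give the same oriented circle, which is the freedom
  used to choose a cusp.\<close>

lemma SL2_Ints_real_circle:
  assumes "S \<in> SL2 \<int>"
  shows "moebius_ocircle S real_circle = real_circle"
proof -
  obtain m p n q where S: "S = mat2 (of_int m) (of_int p) (of_int n) (of_int q)" and det:
      "m * q - p * n = 1"
    using assms by (rule SL2_Ints_E)
  have "of_int m * of_int q - of_int p * of_int n = (1 :: real)" using det
      by (metis of_int_1 of_int_diff of_int_mult)
  then have side: "side S z = Im z" for z
    unfolding S side_def by simp algebra
  have "det S = of_int (m * q - p * n)" by (simp add: S)
  then have "det S \<noteq> 0" using det by simp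
  then show ?thesis
    by (intro ocircle_eqI) (simp_all add: moebius_real_circle_iff real_circle_iff side, simp_all
        add: S)
qed

lemma SL2_Ints_inverse:
  assumes "S \<in> SL2 \<int>"
  obtains T where "T \<in> SL2 \<int>" "S ** T = mat 1" "T ** S = mat 1"
proof -
  obtain a b c d where S: "S = mat2 a b c d" by (rule mat2_cases)
  have "a \<in> \<int>" "b \<in> \<int>" "c \<in> \<int>" "d \<in> \<int>" "a * d - b * c = 1"
    using assms by (simp_all add: S SL2_mat2_iff)
  then show thesis
    using that[of "mat2 d (- b) (- c) a"]
        by (simp add: S SL2_mat2_iff mat2_mult mat2_one[symmetric] algebra_simps)
qed

text \<open>All that the geometry needs from the field. Membership of \<open>w * w\<close> makes the
  lattice a ring, and its imaginary part \<open>2 Re w Im w\<close> also yields the integral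
  trace.\<close>

locale quadratic_order =
  fixes K :: "complex set" and w :: complex
  assumes order_eq: "ring_of_integers K = int_span2 1 w"
    and Im_pos: "Im w > 0"
    and square_in: "w * w \<in> ring_of_integers K"
begin

abbreviation R where "R \<equiv> ring_of_integers K"

lemma R_iff: "x \<in> R \<longleftrightarrow> (\<exists>m n. x = of_int m + of_int n * w)"
  by (simp add: order_eq int_span2_def)

lemma R_of_int [simp]: "of_int k \<in> R"
  unfolding R_iff by (intro exI[of _ k] exI[of _ 0]) simp

lemma R_0_1 [simp]: "0 \<in> R" "1 \<in> R"
  using R_of_int[of 0] R_of_int[of 1] by simp_all

lemma R_generator [simp]: "w \<in> R"
  unfolding R_iff by (intro exI[of _ 0] exI[of _ 1]) simp

lemma R_add [simp]: "x \<in> R \<Longrightarrow> y \<in> R \<Longrightarrow> x + y \<in> R"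
proof -
  assume "x \<in> R" "y \<in> R"
  then obtain m n m' n' where "x = of_int m + of_int n * w" "y = of_int m' + of_int n' * w"
    by (auto simp: R_iff)
  then have "x + y = of_int (m + m') + of_int (n + n') * w" by (simp add: algebra_simps)
  then show ?thesis unfolding R_iff by blast
qed

lemma R_of_int_mult: "x \<in> R \<Longrightarrow> of_int k * x \<in> R"
proof -
  assume "x \<in> R"
  then obtain m n where "x = of_int m + of_int n * w" by (auto simp: R_iff)
  then have "of_int k * x = of_int (k * m) + of_int (k * n) * w" by (simp add: algebra_simps)
  then show ?thesis unfolding R_iff by blast
qed

lemma R_uminus [simp]: "x \<in> R \<Longrightarrow> - x \<in> R"
  using R_of_int_mult[of x "-1"] by simp

lemma R_diff [simp]: "x \<in> R \<Longrightarrow> y \<in> R \<Longrightarrow> x - y \<in> R"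
  using R_add[of x "- y"] by simp

lemma R_mult [simp]: "x \<in> R \<Longrightarrow> y \<in> R \<Longrightarrow> x * y \<in> R"
proof -
  assume "x \<in> R" "y \<in> R"
  then obtain m n where x: "x = of_int m + of_int n * w" by (auto simp: R_iff)
  have "w * y \<in> R"
  proof -
    obtain m' n' where "y = of_int m' + of_int n' * w" using \<open>y \<in> R\<close> by (auto simp: R_iff)
    then have "w * y = of_int m' * w + of_int n' * (w * w)" by (simp add: algebra_simps)
    then show ?thesis using square_in by (simp add: R_of_int_mult)
  qed
  moreover have "x * y = of_int m * y + of_int n * (w * y)" by (simp add: x algebra_simps)
  ultimately show ?thesis using \<open>y \<in> R\<close> by (simp add: R_of_int_mult)
qed

text \<open>The discreteness behind every integer of the proof: heights of lines, coefficients of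
  \<open>side\<close> on the real line, and reduced curvatures are all measured in units of
  \<open>Im w\<close>.\<close>

lemma R_Im: "x \<in> R \<Longrightarrow> \<exists>k. Im x = of_int k * Im w"
  by (auto simp: R_iff)

lemma R_real: "x \<in> R \<Longrightarrow> Im x = 0 \<Longrightarrow> \<exists>k. x = of_int k"
  using Im_pos by (auto simp: R_iff)

lemma trace_int: "\<exists>t. 2 * Re w = of_int t"
proof -
  obtain t where "Im (w * w) = of_int t * Im w" using R_Im[OF square_in] by blast
  then show ?thesis using Im_pos by auto
qed

lemma R_cnj [simp]: "x \<in> R \<Longrightarrow> cnj x \<in> R"
proof -
  assume "x \<in> R"
  then obtain m n where x: "x = of_int m + of_int n * w" by (auto simp: R_iff)
  obtain t where "2 * Re w = of_int t" using trace_int by blast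
  then have "cnj x = of_int (m + n * t) + of_int (- n) * w"
    by (auto simp: x complex_eq_iff algebra_simps)
  then show ?thesis unfolding R_iff by blast
qed

lemma R_norm: "x \<in> R \<Longrightarrow> \<exists>k. x * cnj x = of_int k \<and> (cmod x)\<^sup>2 = of_int k"
proof -
  assume "x \<in> R"
  then obtain k where "x * cnj x = of_int k" using R_real[of "x * cnj x"] by auto
  then have "of_real ((cmod x)\<^sup>2) = (of_int k :: complex)" by (simp only: complex_norm_square)
  then have "(cmod x)\<^sup>2 = of_int k" by (metis of_real_eq_iff of_real_of_int_eq)
  then show ?thesis using \<open>x * cnj x = of_int k\<close> by blast
qed

lemma R_unit: "x \<in> R \<Longrightarrow> y \<in> R \<Longrightarrow> x * y = 1 \<Longrightarrow> cmod x = 1"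
proof -
  assume "x \<in> R" "y \<in> R" "x * y = 1"
  then obtain k l where kl: "(cmod x)\<^sup>2 = of_int k" "(cmod y)\<^sup>2 = of_int l" using R_norm by metis
  have "cmod x * cmod y = 1" using \<open>x * y = 1\<close> by (metis norm_mult norm_one)
  then have "(cmod x)\<^sup>2 * (cmod y)\<^sup>2 = 1" by (simp flip: power_mult_distrib)
  then have "of_int (k * l) = (1 :: real)" using kl by simp
  then have "k * l = 1" by (simp only: of_int_eq_1_iff)
  moreover have "k \<ge> 0" using kl(1) by (metis of_int_0_le_iff zero_le_power2)
  ultimately have "k = 1" by (simp add: zmult_eq_1_iff)
  then have "(cmod x)\<^sup>2 = 1" using kl by simp
  then show ?thesis by (simp add: power2_eq_1_iff) (use norm_ge_zero[of x] in linarith)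
qed

lemma GL2_cmod_det: "M \<in> GL2 R \<Longrightarrow> cmod (det M) = 1"
proof -
  assume M: "M \<in> GL2 R"
  obtain a b c d where eq: "M = mat2 a b c d" by (rule mat2_cases)
  show ?thesis using M unfolding eq GL2_mat2_iff by (auto intro: R_unit)
qed

lemma GL2_det_nonzero: "M \<in> GL2 R \<Longrightarrow> det M \<noteq> 0"
  using GL2_cmod_det by fastforce

lemma GL2_mult: "M \<in> GL2 R \<Longrightarrow> N \<in> GL2 R \<Longrightarrow> M ** N \<in> GL2 R"
proof -
  assume MN: "M \<in> GL2 R" "N \<in> GL2 R"
  then obtain u v where uv: "u \<in> R" "v \<in> R" "det M * u = 1" "det N * v = 1" by (auto simp: GL2_def)
  have "det (M ** N) * (u * v) = (det M * u) * (det N * v)" by (simp add: det_mul algebra_simps)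
  also have "\<dots> = 1" by (simp only: uv mult_1)
  finally have "\<exists>u\<in>R. det (M ** N) * u = 1" using uv R_mult by blast
  then show ?thesis using MN by (auto simp: GL2_def matrix_matrix_mult_def sum_2)
qed

lemma GL2_inverse:
  assumes "M \<in> GL2 R"
  obtains N where "N \<in> GL2 R" "M ** N = mat 1" "N ** M = mat 1"
proof -
  obtain a b c d where M: "M = mat2 a b c d" by (rule mat2_cases)
  obtain u where R: "a \<in> R" "b \<in> R" "c \<in> R" "d \<in> R" "u \<in> R" and u: "(a * d - b * c) * u = 1"
    using assms by (auto simp: M GL2_mat2_iff)
  let ?N = "mat2 (u * d) (- u * b) (- u * c) (u * a)"
  have inv: "M ** ?N = mat 1" "?N ** M = mat 1"
    using u by (simp_all add: M mat2_mult mat2_one[symmetric] algebra_simps)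
  have "(u * d) * (u * a) - (- u * b) * (- u * c) = u * ((a * d - b * c) * u)"
      by (simp add: algebra_simps)
  then have "((u * d) * (u * a) - (- u * b) * (- u * c)) * (a * d - b * c) = 1"
    unfolding u using u by (simp add: algebra_simps)
  then have "?N \<in> GL2 R" using R unfolding GL2_mat2_iff by (auto intro!: bexI[of _ "a * d - b * c"])
  then show thesis using inv that by blast
qed

lemma SL2_in_GL2: "M \<in> SL2 R \<Longrightarrow> M \<in> GL2 R"
  by (auto simp: SL2_def GL2_def intro: bexI[of _ 1])

lemma SL2_Ints_in_GL2: "S \<in> SL2 \<int> \<Longrightarrow> S \<in> GL2 R"
  by (rule SL2_in_GL2) (auto simp: SL2_def elim!: Ints_cases, metis R_of_int Ints_cases)

lemma SL2_Ints_mult_real_circle: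
  "S \<in> SL2 \<int> \<Longrightarrow> moebius_ocircle (M ** S) real_circle = moebius_ocircle M real_circle"
  by (simp add: moebius_ocircle_mult GL2_det_nonzero SL2_Ints_in_GL2 SL2_Ints_real_circle)

text \<open>A Bianchi circle through infinity reaches it at a cusp, i.e. at a rational parameter.\<close>

lemma GL2_upper_triangular:
  assumes M: "M \<in> GL2 R" and inf: "None \<in> moebius M ` underlying real_circle"
  obtains S where "S \<in> SL2 \<int>" "(M ** S) $ 2 $ 1 = 0"
proof -
  obtain a b c d where eq: "M = mat2 a b c d" by (rule mat2_cases)
  have R: "c \<in> R" "d \<in> R" using M by (simp_all add: eq GL2_mat2_iff)
  have "Im (cnj c * d) = 0" using moebius_real_circle_iff(1)[OF GL2_det_nonzero[OF M]] inf
      by (simp add: eq)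
  \<comment> \<open>With \<open>l\<close> the norm of \<open>c\<close>, the quotient
    \<open>d / c = k / l\<close> is rational.\<close>
  then obtain k where k: "cnj c * d = of_int k" using R_real[of "cnj c * d"] R by auto
  obtain l where l: "c * cnj c = of_int l" using R_norm[OF R(1)] by blast
  show thesis
  proof (cases "c = 0")
    case True
    then show thesis using that[OF SL2_Ints_one] by (simp add: eq)
  next
    case False
    then have "l \<noteq> 0" using l by auto
    define g where "g = gcd k l"
    have "g \<noteq> 0" using \<open>l \<noteq> 0\<close> by (simp add: g_def)
    obtain m n where mn: "k = g * m" "l = g * n" "coprime m n"
      using \<open>g \<noteq> 0\<close> unfolding g_def
      by (metis dvd_div_mult_self div_gcd_coprime gcd_eq_0_iff gcd_dvd1 gcd_dvd2 mult.commute)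
    have "of_int g * (d * of_int n - c * of_int m) = d * of_int l - c * of_int k"
      by (simp add: mn algebra_simps)
    also have "\<dots> = 0" by (simp flip: k l)
    finally have "of_int g * (d * of_int n - c * of_int m) = 0" .
    then have 0: "d * of_int n - c * of_int m = 0" using \<open>g \<noteq> 0\<close> by auto
    \<comment> \<open>The parameter \<open>-m / n = -d / c\<close> is the one that \<open>M\<close>
      sends to infinity.\<close>
    have "coprime (- m) n" using mn(3) by simp
    then obtain p q where S: "mat2 (of_int (- m)) (of_int p) (of_int n) (of_int q) \<in> SL2 \<int>"
      using SL2_Ints_column by blast
    then show thesis using that[OF S] 0 by (simp add: eq mat2_mult algebra_simps)
  qed
qed

text \<open>
  On the real line \<^const>\<open>side\<close> is a quadratic polynomial with coefficients in \<open>\<int> Im w\<close>; tangency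
  makes its root a double one, hence rational.
\<close>

lemma tangency_cusp:
  assumes M: "M \<in> GL2 R"
    and meet: "underlying real_circle \<inter> moebius M ` underlying real_circle = {p}"
  obtains S where "S \<in> SL2 \<int>" "p = moebius S None"
proof (cases p)
  case None
  then show thesis using that[OF SL2_Ints_one] by simp
next
  case (Some z)
  obtain a b c d where eq: "M = mat2 a b c d" by (rule mat2_cases)
  have R: "a \<in> R" "b \<in> R" "c \<in> R" "d \<in> R" using M by (simp_all add: eq GL2_mat2_iff)
  note iff = moebius_real_circle_iff[OF GL2_det_nonzero[OF M]]
  obtain kA kB kD where k: "Im (cnj c * d) = of_int kA * Im w"
    "Im (d * cnj a - cnj b * c) = of_int kB * Im w" "Im (b * cnj a) = of_int kD * Im w"
    using R_Im R by (metis R_cnj R_diff R_mult)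
  have side: "side M (of_real t) = (of_int kB * t - of_int kA * t\<^sup>2 - of_int kD) * Im w" for t
  proof -
    have "side M (of_real t) =
        Im (d * cnj a - cnj b * c) * t - Im (cnj c * d) * t\<^sup>2 - Im (b * cnj a)"
      unfolding side_def eq by (simp add: power2_eq_square algebra_simps)
    then show ?thesis unfolding k by (simp add: algebra_simps)
  qed
  have mem: "Some (of_real t) \<in> {p} \<longleftrightarrow> of_int kB * t - of_int kA * t\<^sup>2 - of_int kD = 0" for t
    using Im_pos by (simp add: meet[symmetric] real_circle_iff iff side)
  have "Im z = 0" using meet Some real_circle_iff(1) by blast
  then obtain x where x: "z = of_real x" by (metis complex_is_Real_iff of_real_Re)
  \<comment> \<open>Otherwise infinity would be a second common point.\<close>
  have "kA \<noteq> 0"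
  proof
    assume "kA = 0"
    then have "Im (cnj (M$2$1) * M$2$2) = 0" using k(1) by (simp add: eq)
    then have "None \<in> {p}" unfolding meet[symmetric] by (simp add: real_circle_iff iff)
    then show False using Some by simp
  qed
  \<comment> \<open>The other root, by Vieta. It is a common point too, hence equal to
    \<open>x\<close>, which makes \<open>x\<close> half the rational sum of the roots.\<close>
  define x' where "x' = of_int kB / of_int kA - x"
  have "of_int kB * x' - of_int kA * x'\<^sup>2 - of_int kD = of_int kB * x - of_int kA * x\<^sup>2 - of_int kD"
    using \<open>kA \<noteq> 0\<close> by (simp add: x'_def power2_eq_square field_simps)
  also have "\<dots> = 0" using mem[of x] Some x by simp
  finally have "x' = x" using mem[of x'] Some x by simp
  then have x_eq: "x = of_int kB / of_int (2 * kA)" using \<open>kA \<noteq> 0\<close> by (simp add: x'_def field_simps)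
  have "of_int kB / of_int (2 * kA) \<in> (\<rat> :: real set)" by simp
  then obtain m n where mn: "n > 0" "coprime m n" "x = of_int m / of_int n"
    unfolding x_eq by (elim Rats_cases')
  obtain p' q where S: "mat2 (of_int m) (of_int p') (of_int n) (of_int q) \<in> SL2 \<int>"
    using SL2_Ints_column[OF mn(2)] by blast
  have "p = moebius (mat2 (of_int m) (of_int p') (of_int n) (of_int q)) None"
    using mn by (simp add: Some x moebius_def)
  then show thesis using that[OF S] by blast
qed

lemma GL2_triangular_unit:
  assumes M: "mat2 a b 0 d \<in> GL2 R"
  obtains e where "e \<in> R" "d * e = 1" "cmod a = 1" "cmod d = 1"
proof -
  obtain u where R: "a \<in> R" "d \<in> R" "u \<in> R" and u: "a * d * u = 1"
    using assms by (auto simp: GL2_mat2_iff)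
  have "a * (d * u) = 1" "d * (a * u) = 1" using u by (simp_all add: algebra_simps)
  then show thesis using that[of "a * u"] R_unit[of a "d * u"] R_unit[of d "a * u"] R by simp
qed

lemma unit_real_cases: "cmod v = 1 \<Longrightarrow> Im v = 0 \<Longrightarrow> v = 1 \<or> v = -1"
  by (auto simp: cmod_def complex_eq_iff real_sqrt_eq_1_iff power2_eq_1_iff)

text \<open>
  This excludes \<open>det M = \<plusminus>\<i>\<close> over the Gaussian integers, where \<open>M(\<real>)\<close> is an image of the
  real line under \<open>GL\<^sub>2\<close> but not under \<open>SL\<^sub>2\<close>.
\<close>

lemma det_bianchi:
  assumes M: "M \<in> GL2 R" and bianchi: "moebius M ` underlying real_circle \<in> bianchi_circles K"
  obtains d e where "d \<in> R" "e \<in> R" "d * e = 1" "det M = d\<^sup>2 \<or> det M = - (d\<^sup>2)"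
proof -
  obtain N where N: "N \<in> SL2 R" "moebius M ` underlying real_circle
      = moebius N ` underlying real_circle"
    using bianchi by (auto simp: bianchi_circles_def)
  obtain N' where N': "N' \<in> GL2 R" "N ** N' = mat 1" "N' ** N = mat 1"
    using GL2_inverse[OF SL2_in_GL2[OF N(1)]] by blast
  \<comment> \<open>\<open>X\<close> maps the real line onto itself, so a right factor from
    \<open>SL\<^sub>2(\<int>)\<close> makes it upper triangular.\<close>
  define X where "X = N' ** M"
  have X: "X \<in> GL2 R" using N' M by (simp add: X_def GL2_mult)
  have "moebius X p = moebius N' (moebius M p)" for p
    unfolding X_def by (rule moebius_mult[OF GL2_det_nonzero[OF M]])
  then have "moebius X ` underlying real_circle = moebius N' ` moebius M ` underlying real_circle"
    by (simp add: image_image)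
  also have "\<dots> = underlying real_circle" by (simp add: N(2) image_image moebius_inverse[OF N'(3)])
  finally have fixed: "moebius X ` underlying real_circle = underlying real_circle" .
  then have "None \<in> moebius X ` underlying real_circle" by (simp add: real_circle_iff)
  then obtain S where S: "S \<in> SL2 \<int>" "(X ** S) $ 2 $ 1 = 0" using GL2_upper_triangular[OF X]
      by blast
  obtain a b c d where Y: "X ** S = mat2 a b c d" by (rule mat2_cases)
  then have "c = 0" using S(2) by simp
  have YG: "mat2 a b 0 d \<in> GL2 R"
    using GL2_mult[OF X SL2_Ints_in_GL2[OF S(1)]] Y \<open>c = 0\<close> by simp
  obtain e where e: "e \<in> R" "d * e = 1" "cmod a = 1" "cmod d = 1" using GL2_triangular_unit[OF YG] .
  have fixY: "moebius (X ** S) ` underlying real_circle = underlying real_circle"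
    using SL2_Ints_mult_real_circle[OF S(1), of X] fixed by (metis moebius_ocircle_sel(1))
  have side: "side (X ** S) z = 0 \<longleftrightarrow> Im z = 0" for z
    using moebius_real_circle_iff(3)[of
        "X ** S" z] GL2_det_nonzero[OF YG] fixY real_circle_iff(1)[of z]
    by (simp add: Y \<open>c = 0\<close>)
  \<comment> \<open>The real points 0 and 1 show that \<open>d * cnj a\<close> is real. Having
    modulus 1 it is \<plusminus>1, so \<open>a = \<plusminus>d\<close> and the determinant is
    \<open>\<plusminus>d\<^sup>2\<close>.\<close>
  have "Im (b * cnj a) = 0" using side[of 0] by (simp add: side_def Y \<open>c = 0\<close>)
  moreover have "Im ((d - b) * cnj a) = 0" using side[of 1] by (simp add: side_def Y \<open>c = 0\<close>)
  ultimately have "Im (d * cnj a) = 0" by (simp add: algebra_simps)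
  moreover have "cmod (d * cnj a) = 1" using e by (simp add: norm_mult)
  ultimately have "d * cnj a = 1 \<or> d * cnj a = - 1" by (intro unit_real_cases)
  moreover have "cnj a * a = 1" using e(3)
      by (simp add: complex_norm_square[symmetric] mult.commute)
  ultimately have "d = a \<or> d = - a"
      by (metis mult.assoc mult.left_neutral mult.right_neutral mult_minus_left)
  then have ad: "a * d = d\<^sup>2 \<or> a * d = - (d\<^sup>2)" by (auto simp: power2_eq_square)
  have "det N = 1" using N(1) by (simp add: SL2_def)
  have "det S = 1" using S(1) by (simp add: SL2_def)
  have "det N' = 1" using N'(2) \<open>det N = 1\<close> by (metis det_I det_mul mult_1)
  then have "det M = det (X ** S)" using \<open>det S = 1\<close> by (simp add: X_def det_mul)
  also have "\<dots> = a * d" by (simp add: Y \<open>c = 0\<close>)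
  finally have "det M = d\<^sup>2 \<or> det M = - (d\<^sup>2)" using ad by simp
  moreover have "d \<in> R" using YG by (simp add: GL2_mat2_iff)
  ultimately show thesis using that e by blast
qed

text \<open>Scaling by the inverse \<open>e\<close> of the unit \<open>d\<close> with
  \<open>det M = \<plusminus>d\<^sup>2\<close> makes the determinant \<plusminus>1 without changing
  the map; \<open>flip\<close> then repairs the sign without changing the underlying circle.\<close>

lemma bianchi_circle_mult:
  assumes M: "M \<in> GL2 R" and bianchi: "moebius M ` underlying real_circle \<in> bianchi_circles K"
    and E: "E \<in> GL2 R" "det E = 1 \<or> det E = - 1"
  shows "oriented_bianchi_circle K (moebius_ocircle (M ** E) real_circle)"
proof -
  obtain d e where de: "d \<in> R" "e \<in> R" "d * e = 1" "det M = d\<^sup>2 \<or> det M = - (d\<^sup>2)"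
    using det_bianchi[OF M bianchi] .
  have ME: "M ** E \<in> GL2 R" using M E by (simp add: GL2_mult)
  define U where "U = mat2 e 0 0 e"
  define P where "P = U ** (M ** E)"
  have "e \<noteq> 0" using de by auto
  have "moebius U p = p" for p using \<open>e \<noteq> 0\<close> by (cases p) (simp_all add: U_def moebius_def)
  then have P_eq: "moebius P = moebius (M ** E)"
    unfolding P_def by (simp add: fun_eq_iff moebius_mult[OF GL2_det_nonzero[OF ME]])
  have "e * e * (d * d) = 1" using de(3) by (metis mult.assoc mult.commute mult.left_neutral)
  then have detP: "det P = 1 \<or> det P = - 1"
    using de(4) E(2) by (auto simp: P_def U_def det_mul power2_eq_square)
  have "U \<in> GL2 R" unfolding U_def GL2_mat2_iff
    using de \<open>e * e * (d * d) = 1\<close> by (auto intro!: bexI[of _ "d * d"])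
  then have P_R: "P \<in> GL2 R" unfolding P_def using ME by (rule GL2_mult)
  have flipG: "flip \<in> GL2 R" by (auto simp: GL2_mat2_iff intro!: bexI[of _ "- 1"])
  have SL2: "N \<in> SL2 R" if "N \<in> GL2 R" "det N = 1" for N using that by (simp add: GL2_def SL2_def)
  have "\<exists>N\<in>SL2 R. moebius P ` underlying real_circle = moebius N ` underlying real_circle"
    using detP
  proof
    assume "det P = - 1"
    then have "P ** flip \<in> SL2 R" by (intro SL2 GL2_mult P_R flipG) (simp add: det_mul)
    moreover have "moebius (P ** flip) ` underlying real_circle
        = moebius P ` underlying real_circle"
      using moebius_ocircle_mult[of flip P real_circle] moebius_flip(1)
      by (simp add: moebius_ocircle_def)
    ultimately show ?thesis by metis
  qed (use SL2 P_R in blast)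
  then show ?thesis
    using moebius_ocircle_real_circle_oriented(1)[OF GL2_cmod_det[OF ME]]
    by (auto simp: oriented_bianchi_circle_def bianchi_circles_def P_eq)
qed

lemma oriented_bianchi_circle_GL2:
  assumes "oriented_bianchi_circle K D"
  obtains N where "N \<in> GL2 R" "D = moebius_ocircle N real_circle"
proof -
  obtain N where N: "N \<in> SL2 R" "underlying D = moebius N ` underlying real_circle"
      "oriented_circle D"
    using assms by (auto simp: oriented_bianchi_circle_def bianchi_circles_def)
  have "flip \<in> GL2 R" by (auto simp: GL2_mat2_iff intro!: bexI[of _ "- 1"])
  then have "N ** flip \<in> GL2 R" "N \<in> GL2 R" using N(1) by (simp_all add: SL2_in_GL2 GL2_mult)
  then show thesis
    using oriented_circle_cases[OF N(3,2)] GL2_cmod_det that by blast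
qed

end

section \<open>Immediate tangency\<close>

context quadratic_order begin

text \<open>The matrix of \<open>z \<mapsto> -z - k w\<close>, which takes the upper half plane to \<open>Im z < - k Im w\<close>.\<close>

definition lower :: "int \<Rightarrow> complex^2^2" where
  "lower k = mat2 (- 1) (- of_int k * w) 0 1"

lemma lower_GL2: "lower k \<in> GL2 R" and det_lower: "det (lower k) = - 1"
  unfolding lower_def GL2_mat2_iff by (auto simp: R_of_int_mult intro!: bexI[of _ "- 1"])

lemma lower_iff:
  "Some z \<in> moebius (lower k) ` underlying real_circle \<longleftrightarrow> Im z = - of_int k * Im w"
  "Some z \<in> moebius (lower k) ` ointerior real_circle \<longleftrightarrow> Im z < - of_int k * Im w"
  "None \<in> moebius (lower k) ` underlying real_circle"
  "None \<notin> moebius (lower k) ` ointerior real_circle"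
  using moebius_real_circle_iff[OF GL2_det_nonzero[OF lower_GL2[of k]]]
  by (auto simp: side_def lower_def)

text \<open>The diagonal entries are units, so \<open>v = d * cnj a\<close> has modulus 1. The line
  \<open>Im (v * z) = k Im w\<close> is horizontal exactly when \<open>v\<close> is real.\<close>

lemma horizontal_line_iff:
  assumes Q: "mat2 a b 0 d \<in> GL2 R"
  obtains v k where "cmod v = 1" "\<And>z. side (mat2 a b 0 d) z = Im (v * z) - of_int k * Im w"
proof -
  have "a \<in> R" "b \<in> R" using Q by (simp_all add: GL2_mat2_iff)
  then obtain k where k: "Im (b * cnj a) = of_int k * Im w" using R_Im[of "b * cnj a"] by auto
  have "cmod (d * cnj a) = 1" using GL2_triangular_unit[OF Q]
      by (metis complex_mod_cnj mult_1 norm_mult)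
  moreover have "side (mat2 a b 0 d) z = Im ((d * cnj a) * z) - of_int k * Im w" for z
    unfolding k[symmetric] side_def by (simp add: algebra_simps)
  ultimately show thesis using that by blast
qed

text \<open>No finite point is common to the two lines, which makes them parallel and distinct;
  disjoint interiors then fix the orientation and put the second line below the real one.\<close>

lemma tangent_at_infinity:
  assumes Q: "Q \<in> GL2 R" and inf: "None \<in> moebius Q ` underlying real_circle"
    and tangent: "externally_tangent real_circle (moebius_ocircle Q real_circle)"
  obtains k where "k \<ge> 1" "moebius_ocircle Q real_circle = moebius_ocircle (lower k) real_circle"
proof -
  obtain S where S: "S \<in> SL2 \<int>" "(Q ** S) $ 2 $ 1 = 0" using GL2_upper_triangular[OF Q inf] .
  obtain a b c d where eq: "Q ** S = mat2 a b c d" by (rule mat2_cases)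
  then have "c = 0" using S(2) by simp
  let ?Q = "mat2 a b 0 d"
  have QG: "?Q \<in> GL2 R" using GL2_mult[OF Q SL2_Ints_in_GL2[OF S(1)]] eq \<open>c = 0\<close> by simp
  have same: "moebius_ocircle Q real_circle = moebius_ocircle ?Q real_circle"
    using SL2_Ints_mult_real_circle[OF S(1), of Q] eq \<open>c = 0\<close> by simp
  note iff = moebius_real_circle_iff[OF GL2_det_nonzero[OF QG]]
  obtain v k where v: "cmod v = 1" and side: "\<And>z. side ?Q z = Im (v * z) - of_int k * Im w"
    using horizontal_line_iff[OF QG] by blast
  obtain p where "underlying real_circle \<inter> moebius ?Q ` underlying real_circle = {p}"
    using tangent unfolding same externally_tangent_def by auto
  moreover have "None \<in> underlying real_circle \<inter> moebius ?Q ` underlying real_circle"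
    by (simp add: real_circle_iff iff)
  ultimately have "underlying real_circle \<inter> moebius ?Q ` underlying real_circle = {None}"
    by (metis singletonD)
  then have "Some (of_real t) \<notin> underlying real_circle \<inter> moebius ?Q ` underlying real_circle" for t
    by simp
  then have ne: "Im v * t \<noteq> of_int k * Im w" for t by (simp add: real_circle_iff iff side)
  \<comment> \<open>For \<open>Im v \<noteq> 0\<close> this is the parameter at which the lines
    would cross.\<close>
  have "Im v = 0" using ne[of "of_int k * Im w / Im v"] by (auto split: if_splits)
  then have v1: "v = 1 \<or> v = - 1" using v unit_real_cases by blast
  have "k \<noteq> 0" using ne[of 0] by auto
  have "ointerior real_circle \<inter> moebius ?Q ` ointerior real_circle = {}"
    using tangent unfolding same externally_tangent_def by auto
  then have disj: "Im (v * z) \<le> of_int k * Im w" if "Im z > 0" for z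
    using that by (auto simp: disjoint_iff real_circle_iff iff side not_less dest!: spec[of _
        "Some z"])
  have "v \<noteq> 1"
  proof
    assume "v = 1"
    then have "\<bar>of_int k * Im w\<bar> + 1 \<le> of_int k * Im w" using disj[of "\<i> * (\<bar>of_int k * Im w\<bar> + 1)"]
        by simp
    then show False by linarith
  qed
  then have "v = - 1" using v1 by simp
  have "k \<ge> 1"
  proof (rule ccontr)
    assume "\<not> k \<ge> 1"
    then have "of_int k * Im w < 0" using \<open>k \<noteq> 0\<close> Im_pos by (simp add: mult_neg_pos)
    \<comment> \<open>The point halfway between the two lines would be in both interiors.\<close>
    then show False using disj[of "Complex 0 (- (of_int k * Im w) / 2)"]
        by (simp add: \<open>v = - 1\<close> mult.commute)
  qed
  moreover have "moebius_ocircle ?Q real_circle = moebius_ocircle (lower k) real_circle"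
    by (intro ocircle_eqI) (auto simp: lower_iff iff side \<open>v = - 1\<close>)
  ultimately show thesis using that same by simp
qed

lemma tangent_real_circle:
  assumes Q: "Q \<in> GL2 R" and tangent:
      "externally_tangent real_circle (moebius_ocircle Q real_circle)"
  obtains S k where "S \<in> SL2 \<int>" "k \<ge> 1"
    "moebius_ocircle Q real_circle = moebius_ocircle (S ** lower k) real_circle"
proof -
  obtain p where p: "underlying real_circle \<inter> moebius Q ` underlying real_circle = {p}"
    using tangent by (auto simp: externally_tangent_def)
  obtain S where S: "S \<in> SL2 \<int>" "p = moebius S None" using tangency_cusp[OF Q p] .
  obtain T where T: "T \<in> SL2 \<int>" "S ** T = mat 1" "T ** S = mat 1" using SL2_Ints_inverse[OF S(1)] .
  note TG = SL2_Ints_in_GL2[OF T(1)] and SG = SL2_Ints_in_GL2[OF S(1)]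
  have TQ: "moebius_ocircle (T ** Q) real_circle
      = moebius_ocircle T (moebius_ocircle Q real_circle)"
    by (rule moebius_ocircle_mult[OF GL2_det_nonzero[OF Q]])
  have "externally_tangent (moebius_ocircle T real_circle) (moebius_ocircle (T ** Q) real_circle)"
    unfolding TQ externally_tangent_moebius_ocircle[OF GL2_det_nonzero[OF TG]] by (rule tangent)
  then have "externally_tangent real_circle (moebius_ocircle (T ** Q) real_circle)"
    by (simp add: SL2_Ints_real_circle[OF T(1)])
  moreover have "None \<in> moebius (T ** Q) ` underlying real_circle"
  proof -
    have "moebius T p \<in> moebius T ` moebius Q ` underlying real_circle" using p by blast
    then show ?thesis
      by (simp add: S(2) moebius_inverse[OF T(3)] image_image moebius_mult[OF GL2_det_nonzero[OF
          Q]])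
  qed
  ultimately obtain k where k: "k \<ge> 1"
    "moebius_ocircle (T ** Q) real_circle = moebius_ocircle (lower k) real_circle"
    using tangent_at_infinity[OF GL2_mult[OF TG Q]] by blast
  have "moebius_ocircle (S ** lower k) real_circle
      = moebius_ocircle S (moebius_ocircle (T ** Q) real_circle)"
    unfolding k(2) by (rule moebius_ocircle_mult) (simp add: det_lower)
  also have "\<dots> = moebius_ocircle (S ** (T ** Q)) real_circle"
    by (rule moebius_ocircle_mult[symmetric, OF GL2_det_nonzero[OF GL2_mult[OF TG Q]]])
  also have "\<dots> = moebius_ocircle Q real_circle" by (simp add: matrix_mul_assoc T(2))
  finally show thesis using that[OF S(1) k(1)] by simp
qed

text \<open>Both lines contain infinity, so a straddling circle does as well and is a line; it must
  be parallel to them and lie strictly between consecutive heights. All of \<open>GL2\<close> is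
  covered because pulling a Bianchi circle back along \<open>M\<close> need not stay in the orbit of
  \<open>SL2\<close>.\<close>

lemma not_straddles_adjacent:
  assumes P: "P \<in> GL2 R"
  shows "\<not> straddles {underlying real_circle, moebius (lower 1) ` underlying real_circle}
           (moebius_ocircle P real_circle)"
proof
  assume str: "straddles {underlying real_circle, moebius (lower 1) ` underlying real_circle}
           (moebius_ocircle P real_circle)"
  \<comment> \<open>With the real line as height 0, both lines of the pair are
    \<open>lower i\<close> with \<open>i \<in> {0, 1}\<close>.\<close>
  have "moebius (lower 0) ` underlying real_circle = underlying real_circle"
  proof (rule set_eqI)
    show "p \<in> moebius (lower 0) ` underlying real_circle \<longleftrightarrow> p \<in> underlying real_circle" for p
      by (cases p) (simp_all add: lower_iff real_circle_iff)
  qed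
  then obtain i j where ij: "i \<in> {0, 1}" "j \<in> {0, 1}"
    and i: "moebius (lower i) ` underlying real_circle \<noteq> moebius P ` underlying real_circle"
      "moebius (lower i) ` underlying real_circle \<inter> moebius P ` ointerior real_circle = {}"
    and j: "moebius (lower j) ` underlying real_circle \<noteq> moebius P ` underlying real_circle"
      "moebius (lower j) ` underlying real_circle \<inter> oexterior (moebius_ocircle P real_circle) = {}"
    using str unfolding straddles_def
        by (metis insertE insertI1 insertI2 moebius_ocircle_sel singletonD)
  have "None \<in> moebius P ` underlying real_circle"
  proof -
    have "None \<notin> moebius P ` ointerior real_circle" using i(2) lower_iff(3)[of i] by blast
    moreover have "None \<notin> oexterior (moebius_ocircle P real_circle)" using j(2) lower_iff(3)[of j]
        by blast
    ultimately show ?thesis by (simp add: oexterior_def)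
  qed
  then obtain S where S: "S \<in> SL2 \<int>" "(P ** S) $ 2 $ 1 = 0" using GL2_upper_triangular[OF P]
      by blast
  obtain a b c d where eq: "P ** S = mat2 a b c d" by (rule mat2_cases)
  then have "c = 0" using S(2) by simp
  let ?Q = "mat2 a b 0 d"
  have QG: "?Q \<in> GL2 R" using GL2_mult[OF P SL2_Ints_in_GL2[OF S(1)]] eq \<open>c = 0\<close> by simp
  have same: "moebius_ocircle P real_circle = moebius_ocircle ?Q real_circle"
    using SL2_Ints_mult_real_circle[OF S(1), of P] eq \<open>c = 0\<close> by simp
  then have same': "moebius P ` underlying real_circle = moebius ?Q ` underlying real_circle"
    "moebius P ` ointerior real_circle = moebius ?Q ` ointerior real_circle"
    by (simp_all add: moebius_ocircle_def)
  note iff = moebius_real_circle_iff[OF GL2_det_nonzero[OF QG]]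
  obtain v k where v: "cmod v = 1" and side: "\<And>z. side ?Q z = Im (v * z) - of_int k * Im w"
    using horizontal_line_iff[OF QG] by blast
  have i_le: "side ?Q z \<le> 0" if "Im z = - of_int i * Im w" for z
  proof -
    have "Some z \<in> moebius (lower i) ` underlying real_circle" using that by (simp add: lower_iff)
    then have "Some z \<notin> moebius ?Q ` ointerior real_circle" using i(2) unfolding same' by blast
    then show ?thesis by (simp add: iff not_less)
  qed
  have j_ge: "side ?Q z \<ge> 0" if "Im z = - of_int j * Im w" for z
  proof -
    have "Some z \<in> moebius (lower j) ` underlying real_circle" using that by (simp add: lower_iff)
    then have "Some z \<notin> oexterior (moebius_ocircle ?Q real_circle)" using j(2) unfolding same
        by blast
    then show ?thesis by (auto simp: oexterior_def iff)
  qed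
  have "Im v = 0"
  proof (rule ccontr)
    assume "Im v \<noteq> 0"
    \<comment> \<open>Chosen so that \<open>side\<close> equals 1: a transversal line has points of
      line \<open>i\<close> in its interior.\<close>
    define t where "t = (Re v * (of_int i * Im w) + of_int k * Im w + 1) / Im v"
    have "side ?Q (Complex t (- of_int i * Im w)) = 1"
      using \<open>Im v \<noteq> 0\<close> by (simp add: side t_def)
    then show False using i_le[of "Complex t (- of_int i * Im w)"] by simp
  qed
  then have "v = 1 \<or> v = - 1" using v unit_real_cases by blast
  then obtain s :: int where s: "s = 1 \<or> s = - 1" "v = of_int s" by force
  have side': "side ?Q z = of_int (- s * l - k) * Im w" if "Im z = - of_int l * Im w" for z l
    using that by (simp add: side s(2) algebra_simps)
  have line: "moebius (lower l) ` underlying real_circle = moebius ?Q ` underlying real_circle"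
    if "- s * l - k = 0" for l
  proof (rule set_eqI)
    have "Im z = - of_int l * Im w \<longleftrightarrow> side ?Q z = 0" for z
    proof
      assume "side ?Q z = 0"
      then have "of_int s * Im z = of_int k * Im w" by (simp add: side s(2))
      moreover have "k = - s * l" using that by simp
      ultimately show "Im z = - of_int l * Im w" using s(1) by auto
    next
      assume "Im z = - of_int l * Im w"
      then have "side ?Q z = of_int (- s * l - k) * Im w" by (rule side')
      then show "side ?Q z = 0" by (simp only: that of_int_0 mult_zero_left)
    qed
    then show "p \<in> moebius (lower l) ` underlying real_circle
        \<longleftrightarrow> p \<in> moebius ?Q ` underlying real_circle" for p
      by (cases p) (simp_all add: lower_iff iff)
  qed
  have "of_int (- s * i - k) * Im w \<le> 0" "of_int (- s * j - k) * Im w \<ge> 0"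
    using i_le[of "Complex 0 (- of_int i * Im w)"] j_ge[of "Complex 0 (- of_int j * Im w)"]
      side'[of "Complex 0 (- of_int i * Im w)" i] side'[of "Complex 0 (- of_int j * Im w)" j]
          by simp_all
  then have "- s * i - k \<le> 0" "- s * j - k \<ge> 0"
    using Im_pos by (simp_all only: mult_le_0_iff zero_le_mult_iff of_int_le_0_iff of_int_0_le_iff)
        linarith+
  moreover have "- s * i - k \<noteq> 0" "- s * j - k \<noteq> 0"
    using line i(1) j(1) unfolding same' by blast+
  \<comment> \<open>\<open>i\<close> and \<open>j\<close> are 0 or 1 and \<open>s\<close> is
    \<plusminus>1, so the bounds differ by at most 1 and leave no room for \<open>k\<close>.\<close>
  ultimately have "- s * i < k" "k < - s * j" by linarith+
  then show False using ij s(1) by auto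
qed

text \<open>The line of \<open>lower 1\<close> separates the real line from every line further down,
  which rules out all tangent circles except the nearest.\<close>

lemma straddles_lower:
  assumes "k \<ge> 2"
  shows "straddles {underlying real_circle, moebius (lower k) ` underlying real_circle}
           (moebius_ocircle (lower 1) real_circle)"
proof -
  have ne: "of_int k * Im w > Im w" using assms Im_pos by simp
  have "Some 0 \<in> underlying real_circle" "Some 0 \<notin> moebius (lower 1) ` underlying real_circle"
    using Im_pos by (simp_all add: real_circle_iff lower_iff)
  then have 1: "underlying real_circle \<noteq> moebius (lower 1) ` underlying real_circle" by blast
  have "Some (- of_int k * w) \<in> moebius (lower k) ` underlying real_circle"
    "Some (- of_int k * w) \<notin> moebius (lower 1) ` underlying real_circle"
    using assms Im_pos by (simp_all add: lower_iff)
  then have 2: "moebius (lower k) ` underlying real_circle \<noteq> moebius (lower 1) ` underlying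
      real_circle"
    by blast
  have "p \<notin> underlying real_circle \<inter> moebius (lower 1) ` ointerior real_circle" for p
    using Im_pos by (cases p) (auto simp: real_circle_iff lower_iff)
  then have 3: "underlying real_circle \<inter> moebius (lower 1) ` ointerior real_circle = {}" by blast
  have "p \<notin> moebius (lower k) ` underlying real_circle \<inter> oexterior (moebius_ocircle (lower 1)
      real_circle)" for p
    using ne by (cases p) (auto simp: oexterior_def lower_iff)
  then have 4: "moebius (lower k) ` underlying real_circle \<inter> oexterior (moebius_ocircle (lower 1)
      real_circle) = {}"
    by blast
  show ?thesis unfolding straddles_def using 1 2 3 4 by auto
qed

text \<open>Pulling back along \<open>M ** S\<close>, where \<open>S\<close> sends infinity to the
  parameter of tangency, turns \<open>C\<close> into the real line and \<open>C'\<close> into some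
  \<open>lower k\<close>; the straddling condition is exactly \<open>k = 1\<close>.\<close>

lemma immediately_tangent_iff:
  assumes M: "M \<in> GL2 R" and C: "C = moebius_ocircle M real_circle" and bianchi:
      "oriented_bianchi_circle K C"
  shows "immediately_tangent K C C' \<longleftrightarrow>
    (\<exists>S\<in>SL2 \<int>. C' = moebius_ocircle (M ** S ** lower 1) real_circle)"
proof -
  have circle: "moebius M ` underlying real_circle \<in> bianchi_circles K"
    using bianchi by (simp add: oriented_bianchi_circle_def C)
  have MS: "M ** S \<in> GL2 R" if "S \<in> SL2 \<int>" for S using that M
      by (simp add: GL2_mult SL2_Ints_in_GL2)
  have C_eq: "C = moebius_ocircle (M ** S) real_circle" if "S \<in> SL2 \<int>" for S
    using that by (simp add: C SL2_Ints_mult_real_circle)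
  have lower_eq: "moebius_ocircle (N ** lower k) real_circle
      = moebius_ocircle N (moebius_ocircle (lower k) real_circle)"
    for N k by (rule moebius_ocircle_mult) (simp add: det_lower)
  \<comment> \<open>This supplies both the neighbour itself and, when \<open>k \<ge> 2\<close>, the
    Bianchi circle that straddles the pair.\<close>
  have lower_bianchi: "oriented_bianchi_circle K (moebius_ocircle (M ** S ** lower k) real_circle)"
    if "S \<in> SL2 \<int>" for S k
  proof (rule bianchi_circle_mult)
    show "moebius (M ** S) ` underlying real_circle \<in> bianchi_circles K"
      using bianchi unfolding C_eq[OF that] by (simp add: oriented_bianchi_circle_def)
  qed (use that in \<open>simp_all add: MS lower_GL2 det_lower\<close>)
  show ?thesis
  proof
    assume "immediately_tangent K C C'"
    then have C': "oriented_bianchi_circle K C'" and tangent: "externally_tangent C C'"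
      and no_straddle: "\<And>D. oriented_bianchi_circle K D
          \<Longrightarrow> \<not> straddles {underlying C, underlying C'} D"
      by (auto simp: immediately_tangent_def oriented_bianchi_circle_def)
    obtain N where N: "N \<in> GL2 R" "C' = moebius_ocircle N real_circle"
      using oriented_bianchi_circle_GL2[OF C'] .
    obtain M' where M': "M' \<in> GL2 R" "M ** M' = mat 1" "M' ** M = mat 1" using GL2_inverse[OF M] .
    have Q: "M' ** N \<in> GL2 R" using M' N by (simp add: GL2_mult)
    have "M ** (M' ** N) = N" by (simp add: matrix_mul_assoc M'(2))
    then have C'_eq: "C' = moebius_ocircle M (moebius_ocircle (M' ** N) real_circle)"
      using moebius_ocircle_mult[OF GL2_det_nonzero[OF Q], of M real_circle] N(2) by simp
    have "externally_tangent real_circle (moebius_ocircle (M' ** N) real_circle)"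
      using tangent unfolding C C'_eq externally_tangent_moebius_ocircle[OF GL2_det_nonzero[OF M]] .
    then obtain S k where S: "S \<in> SL2 \<int>" "k \<ge> 1"
      "moebius_ocircle (M' ** N) real_circle = moebius_ocircle (S ** lower k) real_circle"
      using tangent_real_circle[OF Q] by blast
    have "S ** lower k \<in> GL2 R" using S(1) by (simp add: GL2_mult SL2_Ints_in_GL2 lower_GL2)
    then have C'_S: "C' = moebius_ocircle (M ** S ** lower k) real_circle"
      unfolding C'_eq S(3) by (simp add: moebius_ocircle_mult GL2_det_nonzero flip:
          matrix_mul_assoc)
    have "k = 1"
    proof (rule ccontr)
      assume "k \<noteq> 1"
      then have "k \<ge> 2" using S(2) by simp
      have "straddles ((`) (moebius (M ** S)) `
          {underlying real_circle, moebius (lower k) ` underlying real_circle})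
          (moebius_ocircle (M ** S) (moebius_ocircle (lower 1) real_circle))"
        unfolding straddles_moebius_ocircle[OF GL2_det_nonzero[OF MS[OF S(1)]]]
        by (rule straddles_lower[OF \<open>k \<ge> 2\<close>])
      then have "straddles {underlying C, underlying C'} (moebius_ocircle (M ** S ** lower 1)
          real_circle)"
        unfolding C_eq[OF S(1)] C'_S lower_eq by simp
      then show False using no_straddle[OF lower_bianchi[OF S(1)]] by blast
    qed
    then show "\<exists>S\<in>SL2 \<int>. C' = moebius_ocircle (M ** S ** lower 1) real_circle"
      using C'_S S(1) by blast
  next
    assume "\<exists>S\<in>SL2 \<int>. C' = moebius_ocircle (M ** S ** lower 1) real_circle"
    then obtain S where S: "S \<in> SL2 \<int>" and C': "C'
        = moebius_ocircle (M ** S ** lower 1) real_circle" ..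
    note det = GL2_det_nonzero[OF MS[OF S]]
    have "externally_tangent real_circle (moebius_ocircle (lower 1) real_circle)"
    proof -
      have "p \<in> underlying real_circle \<inter> moebius (lower 1) ` underlying real_circle \<longleftrightarrow> p \<in> {None}"
          for p
        using Im_pos by (cases p) (auto simp: real_circle_iff lower_iff)
      then have 1: "underlying real_circle \<inter> moebius (lower 1) ` underlying real_circle = {None}"
        by (rule set_eqI)
      have "p \<notin> ointerior real_circle \<inter> moebius (lower 1) ` ointerior real_circle" for p
        using Im_pos by (cases p) (auto simp: real_circle_iff lower_iff)
      then have 2: "ointerior real_circle \<inter> moebius (lower 1) ` ointerior real_circle = {}"
        by (rule equals0I[OF notE])
      show ?thesis unfolding externally_tangent_def moebius_ocircle_sel 1 2 by simp
    qed
    then have "externally_tangent C C'"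
      unfolding C_eq[OF S] C' lower_eq externally_tangent_moebius_ocircle[OF det] .
    moreover have "\<not> straddles {underlying C, underlying C'} D" if D: "oriented_bianchi_circle K D"
        for D
    proof -
      obtain P where P: "P \<in> GL2 R" "D = moebius_ocircle P real_circle"
        using oriented_bianchi_circle_GL2[OF D] .
      obtain N where N: "N \<in> GL2 R" "M ** S ** N = mat 1" "N ** (M ** S) = mat 1"
        using GL2_inverse[OF MS[OF S]] .
      have NP: "N ** P \<in> GL2 R" using N P by (simp add: GL2_mult)
      have "(M ** S) ** (N ** P) = P" by (simp only: matrix_mul_assoc N(2) matrix_mul_lid)
      then have "D = moebius_ocircle (M ** S) (moebius_ocircle (N ** P) real_circle)"
        using moebius_ocircle_mult[OF GL2_det_nonzero[OF NP], of "M ** S" real_circle] P(2) by simp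
      moreover have "{underlying C, underlying C'} = (`) (moebius (M ** S)) `
          {underlying real_circle, moebius (lower 1) ` underlying real_circle}"
        unfolding C_eq[OF S] C' lower_eq by simp
      ultimately show ?thesis
        using not_straddles_adjacent[OF NP]
            by (simp only: straddles_moebius_ocircle[OF det] not_False_eq_True)
    qed
    ultimately show "immediately_tangent K C C'"
      using bianchi lower_bianchi[OF S]
          by (auto simp: immediately_tangent_def C' oriented_bianchi_circle_def)
  qed
qed

text \<open>The discriminant is \<open>t\<^sup>2 - 4 l = - (2 Im w)\<^sup>2\<close> for trace
  \<open>t\<close> and norm \<open>l\<close> of \<open>w\<close>, so the unit of curvature is
  \<open>2 Im w\<close>.\<close>

lemma reduced_curvature_moebius:
  assumes N: "N \<in> GL2 R" and k: "Im (cnj (N$2$1) * N$2$2) = of_int k * Im w"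
  shows "reduced_curvature K (moebius_ocircle N real_circle) = k"
proof -
  obtain t where t: "2 * Re w = of_int t" using trace_int by blast
  obtain l where l: "(cmod w)\<^sup>2 = of_int l" using R_norm[OF R_generator] by blast
  have "of_int (t\<^sup>2 - 4 * l) = - (2 * Im w)\<^sup>2"
    using l by (simp add: cmod_power2 power_mult_distrib flip: t)
  then have disc: "field_discriminant K = t\<^sup>2 - 4 * l" "real_of_int (t\<^sup>2 - 4 * l) = - (2 * Im w)\<^sup>2"
    using field_discriminant_eq[OF order_eq Im_pos] by auto
  then have "sqrt (- of_int (field_discriminant K)) = 2 * Im w"
    using Im_pos by (simp only: disc) (simp add: real_sqrt_mult)
  moreover have "curvature (moebius_ocircle N real_circle) = of_int k * (2 * Im w)"
    using moebius_ocircle_real_circle_oriented(2)[OF GL2_cmod_det[OF N]] k by simp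
  ultimately show ?thesis
    unfolding reduced_curvature_def using Im_pos by (intro the_equality) auto
qed

lemma immediately_tangent_curvatures:
  assumes M: "mat2 \<alpha> \<gamma> \<beta> \<delta> \<in> GL2 R" and C: "C = moebius_ocircle (mat2 \<alpha> \<gamma> \<beta> \<delta>) real_circle"
    and bianchi: "oriented_bianchi_circle K C" and b: "Im (cnj \<beta> * \<delta>) = of_int b * Im w"
  shows "{complex_of_int (reduced_curvature K C') | C'. immediately_tangent K C C'}
      = {x * cnj x - of_int b | x. x \<in> primitive_combinations \<beta> \<delta>}"
proof -
  have curv: "complex_of_int (reduced_curvature K
      (moebius_ocircle (mat2 \<alpha> \<gamma> \<beta> \<delta> ** mat2 (of_int m) (of_int p) (of_int n) (of_int q) ** lower 1)
          real_circle))
      = (of_int m * \<beta> + of_int n * \<delta>) * cnj (of_int m * \<beta> + of_int n * \<delta>) - of_int b"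
    if S: "mat2 (of_int m) (of_int p) (of_int n) (of_int q) \<in> SL2 \<int>" and det: "m * q - p * n = 1"
    for m n p q :: int
  proof -
    define x y where "x = of_int m * \<beta> + of_int n * \<delta>" and "y = of_int p * \<beta> + of_int q * \<delta>"
    let ?N = "mat2 \<alpha> \<gamma> \<beta> \<delta> ** mat2 (of_int m) (of_int p) (of_int n) (of_int q) ** lower 1"
    have N: "?N \<in> GL2 R" using M S by (simp add: GL2_mult SL2_Ints_in_GL2 lower_GL2)
    have row: "?N $ 2 $ 1 = - x" "?N $ 2 $ 2 = y - w * x"
      by (simp_all add: lower_def mat2_mult x_def y_def algebra_simps)
    have "x \<in> R" using M by (simp add: GL2_mat2_iff x_def R_of_int_mult)
    then obtain k where k: "x * cnj x = of_int k" "(cmod x)\<^sup>2 = of_int k" using R_norm by blast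
    \<comment> \<open>The alternating form is multiplied by the determinant of \<open>S\<close>, so
      the new bottom row still gives \<open>b\<close>.\<close>
    have "Im (cnj x * y) = of_int (m * q - p * n) * Im (cnj \<beta> * \<delta>)"
      by (simp add: x_def y_def algebra_simps)
    then have xy: "Im (cnj x * y) = of_int b * Im w" by (simp only: det b of_int_1 mult_1)
    have "cnj (- x) * (y - w * x) = w * (x * cnj x) - cnj x * y" by (simp add: algebra_simps)
    then have "Im (cnj (- x) * (y - w * x)) = of_int (k - b) * Im w"
      by (simp only: minus_complex.sel xy k(1)) (simp add: algebra_simps)
    then have "reduced_curvature K (moebius_ocircle ?N real_circle) = k - b"
      using reduced_curvature_moebius[OF N, of "k - b"] by (simp only: row)
    then show ?thesis using k(1) by (simp add: x_def)
  qed
  show ?thesis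
  proof (intro equalityI subsetI)
    fix r
    assume "r \<in> {complex_of_int (reduced_curvature K C') | C'. immediately_tangent K C C'}"
    then obtain S where S: "S \<in> SL2 \<int>"
      and r: "r = complex_of_int (reduced_curvature K (moebius_ocircle (mat2 \<alpha> \<gamma> \<beta> \<delta> ** S ** lower
          1) real_circle))"
      using immediately_tangent_iff[OF M C bianchi] by auto
    obtain m p n q where eq: "S = mat2 (of_int m) (of_int p) (of_int n) (of_int q)" "m * q - p * n
        = 1"
      using S by (rule SL2_Ints_E)
    have "coprime m n"
    proof (rule coprimeI)
      fix e assume "e dvd m" "e dvd n"
      then have "e dvd m * q - p * n" by simp
      then show "is_unit e" by (simp add: eq(2))
    qed
    then show "r \<in> {x * cnj x - of_int b | x. x \<in> primitive_combinations \<beta> \<delta>}"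
      using curv[OF S[unfolded eq(1)] eq(2)] r unfolding eq(1) primitive_combinations_def by blast
  next
    fix r
    assume "r \<in> {x * cnj x - of_int b | x. x \<in> primitive_combinations \<beta> \<delta>}"
    then obtain m n where "coprime m n"
      and r: "r = (of_int m * \<beta> + of_int n * \<delta>) * cnj (of_int m * \<beta> + of_int n * \<delta>) - of_int b"
      by (auto simp: primitive_combinations_def)
    then obtain p q where S: "mat2 (of_int m) (of_int p) (of_int n) (of_int q) \<in> SL2 \<int>"
      using SL2_Ints_column by blast
    then have "of_int (m * q - p * n) = (1 :: complex)" by (simp add: SL2_mat2_iff)
    then have "m * q - p * n = 1" by (simp only: of_int_eq_1_iff)
    then have "r = complex_of_int (reduced_curvature K
      (moebius_ocircle (mat2 \<alpha> \<gamma> \<beta> \<delta> ** mat2 (of_int m) (of_int p) (of_int n) (of_int q) ** lower 1)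
          real_circle))"
      using curv[OF S] r by simp
    then show "r \<in> {complex_of_int (reduced_curvature K C') | C'. immediately_tangent K C C'}"
      using immediately_tangent_iff[OF M C bianchi] S by blast
  qed
qed

end

text \<open>Independence makes the coordinates \<open>(m, n)\<close> unique, so divisibility of
  \<open>x\<close> in the lattice is divisibility of both coordinates.\<close>

lemma primitive_in_int_span2_iff:
  assumes indep: "Im (cnj v * w) \<noteq> 0"
  shows "primitive_in (int_span2 v w) x \<longleftrightarrow> x \<in> primitive_combinations v w"
proof -
  have inj: "m = m' \<and> n = n'"
    if "of_int m * v + of_int n * w = of_int m' * v + of_int n' * w" for m n m' n' :: int
  proof -
    \<comment> \<open>Pairing with \<open>v\<close> and \<open>w\<close> under the alternating form
      reads off the two coordinates.\<close>
    have "Im (cnj v * (of_int m * v + of_int n * w)) = of_int n * Im (cnj v * w)"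
      "Im (cnj (of_int m * v + of_int n * w) * w) = of_int m * Im (cnj v * w)" for m n :: int
      by (simp_all add: algebra_simps)
    then show ?thesis using that indep by (metis mult_cancel_right of_int_eq_iff)
  qed
  show ?thesis
  proof
    assume "primitive_in (int_span2 v w) x"
    then have "x \<in> int_span2 v w" and "x \<noteq> 0"
      and prim: "\<And>k y. k \<ge> 2 \<Longrightarrow> y \<in> int_span2 v w \<Longrightarrow> x \<noteq> of_int k * y"
      by (auto simp: primitive_in_def)
    then obtain m n where x: "x = of_int m * v + of_int n * w" by (auto simp: int_span2_def)
    define g where "g = gcd m n"
    obtain m' n' where mn: "m = g * m'" "n = g * n'" unfolding g_def
        by (meson dvdE gcd_dvd1 gcd_dvd2)
    have "x = of_int g * (of_int m' * v + of_int n' * w)" by (simp add: x mn algebra_simps)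
    moreover have "of_int m' * v + of_int n' * w \<in> int_span2 v w" by (auto simp: int_span2_def)
    ultimately have "\<not> g \<ge> 2" using prim by blast
    moreover have "g \<noteq> 0" using \<open>x \<noteq> 0\<close> x by (auto simp: g_def)
    moreover have "g \<ge> 0" by (simp add: g_def)
    ultimately have "g = 1" by linarith
    then have "coprime m n" by (simp add: g_def coprime_iff_gcd_eq_1)
    then show "x \<in> primitive_combinations v w" using x by (auto simp: primitive_combinations_def)
  next
    assume "x \<in> primitive_combinations v w"
    then obtain m n where x: "x = of_int m * v + of_int n * w" and co: "coprime m n"
      by (auto simp: primitive_combinations_def)
    have "x \<noteq> 0" using inj[of m n 0 0] x co by auto
    moreover have "x \<noteq> of_int k * y" if k: "k \<ge> 2" and y: "y \<in> int_span2 v w" for k :: int and y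
    proof
      assume eq: "x = of_int k * y"
      obtain m' n' where "y = of_int m' * v + of_int n' * w" using y by (auto simp: int_span2_def)
      then have "of_int m * v + of_int n * w = of_int (k * m') * v + of_int (k * n') * w"
        using eq x by (simp add: algebra_simps)
      from inj[OF this] have "k dvd m" "k dvd n" by simp_all
      then have "is_unit k" using co by (meson coprime_common_divisor)
      then show False using k by simp
    qed
    ultimately show "primitive_in (int_span2 v w) x"
      using x by (auto simp: primitive_in_def int_span2_def)
  qed
qed

text \<open>For \<open>b = 0\<close> the circle is a line and \<beta>, \<delta> are proportional
  over the rationals, so \<Lambda> has too few primitive elements: \<beta> = 0 and \<delta> = 1 give
  \<open>real_circle\<close>, whose neighbours have all squares as reduced curvatures, while the
  primitive elements \<plusminus>1 give only 1. Coprime combinations are right for every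
  \<open>b\<close> and agree with primitive elements when \<open>b \<noteq> 0\<close>.\<close>

theorem theorem4p7:
  fixes K :: "complex set" and C :: ocircle and b :: int
    and \<alpha> \<beta> \<gamma> \<delta> :: complex and M :: "complex^2^2" and \<Lambda> :: "complex set"
  assumes "imaginary_quadratic_field K"
    and "oriented_bianchi_circle K C"
    and "reduced_curvature K C = b"
    and "M = vector [vector [\<alpha>, \<gamma>], vector [\<beta>, \<delta>]]"
    and "M \<in> GL2 (ring_of_integers K)"
    and "C = moebius_ocircle M real_circle"
    and "\<Lambda> = int_span2 \<beta> \<delta>"
  shows "(b \<noteq> 0 \<longrightarrow>
            {complex_of_int (reduced_curvature K C') | C'. immediately_tangent K C C'}
              = {x * cnj x - of_int b | x. primitive_in \<Lambda> x}) \<and>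
         {complex_of_int (reduced_curvature K C') | C'. immediately_tangent K C C'}
              = {x * cnj x - of_int b | x. x \<in> primitive_combinations \<beta> \<delta>}"
proof -
  obtain w where "0 < Im w" "w * w \<in> ring_of_integers K" "ring_of_integers K = int_span2 1 w"
    using ring_of_integers_imaginary_quadratic[OF assms(1)] by blast
  then interpret quadratic_order K w by unfold_locales
  have M_eq: "M = mat2 \<alpha> \<gamma> \<beta> \<delta>" using assms(4) by (simp add: mat2_def)
  then have M: "mat2 \<alpha> \<gamma> \<beta> \<delta> \<in> GL2 R" and C: "C = moebius_ocircle (mat2 \<alpha> \<gamma> \<beta> \<delta>) real_circle"
    using assms(5,6) by simp_all
  have "cnj \<beta> * \<delta> \<in> R" using M by (simp add: GL2_mat2_iff)
  then obtain k where k: "Im (cnj \<beta> * \<delta>) = of_int k * Im w" using R_Im by blast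
  then have "k = b" using reduced_curvature_moebius[OF M, of k] assms(3) C by simp
  then have b: "Im (cnj \<beta> * \<delta>) = of_int b * Im w" using k by simp
  note curvatures = immediately_tangent_curvatures[OF M C assms(2) b]
  have "primitive_in \<Lambda> x \<longleftrightarrow> x \<in> primitive_combinations \<beta> \<delta>" if "b \<noteq> 0" for x
    unfolding assms(7) using that b Im_pos by (intro primitive_in_int_span2_iff) simp
  then show ?thesis using curvatures by simp
qed

end
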